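(* Work in ZFC. In transitive-set potentialism $\mathcal{T}$, the following are equivalent for a transitive set $M$: (1) $\mathrm{Val}_{\mathcal{T}}(M,\mathcal{L}_{\in,M})=\mathrm{S5}$; (2) $M=V_\delta$ for some $\Sigma_2$-correct cardinal $\delta$ (i.e. $V_\delta\prec_{\Sigma_2}V$).
   Context: $\mathcal{T}$ is the potentialist system whose worlds are all transitive sets, with $W$ accessing $U$ iff $W\subseteq U$; $\Diamond\varphi$ at $W$ means $\varphi$ holds at some transitive $U\supseteq W$, $\Box\varphi$ at all such; quantifiers range over the current world. $\mathcal{L}_{\in,M}$ is the language of set theory with parameters from $M$; $\mathrm{Val}_{\mathcal{T}}(M,\mathcal{L}')$ is the set of propositional modal formulas all of whose substitution instances by $\mathcal{L}'$-assertions are true at $M$. *)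

theory Defs
  imports Main
begin

text \<open>
  ``Work in ZFC'' is rendered semantically: the universe of sets is an arbitrary type \<open>'a\<close> with an
  arbitrary relation \<open>E\<close> (read \<open>E x y\<close> as ``x is an element of y'') satisfying the first-order axioms
  of ZFC, with Separation and Replacement as schemes over first-order formulas. The model
  may be ill-founded, so every set-theoretic notion below (ordinal, function, \<open>V\<^sub>\<delta>\<close>,
  cardinal, \<open>\<dots>\<close>) is the internal one, i.e. all its quantifiers range over the elements of the model.
\<close>

datatype 'a trm = Var nat | Par 'a

datatype 'a fm =
    FMem "'a trm" "'a trm"
  | FEq "'a trm" "'a trm"
  | FNeg "'a fm"
  | FAnd "'a fm" "'a fm"
  | FEx nat "'a fm"
  | FAll nat "'a fm"

definition FImp :: "'a fm \<Rightarrow> 'a fm \<Rightarrow> 'a fm" where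
  "FImp \<phi> \<psi> = FNeg (FAnd \<phi> (FNeg \<psi>))"

fun fv_trm :: "'a trm \<Rightarrow> nat set" where
  "fv_trm (Var n) = {n}"
| "fv_trm (Par a) = {}"

fun fv :: "'a fm \<Rightarrow> nat set" where
  "fv (FMem s t) = fv_trm s \<union> fv_trm t"
| "fv (FEq s t) = fv_trm s \<union> fv_trm t"
| "fv (FNeg \<phi>) = fv \<phi>"
| "fv (FAnd \<phi> \<psi>) = fv \<phi> \<union> fv \<psi>"
| "fv (FEx n \<phi>) = fv \<phi> - {n}"
| "fv (FAll n \<phi>) = fv \<phi> - {n}"

abbreviation params :: "'a fm \<Rightarrow> 'a set" where
  "params \<equiv> set_fm"

fun val :: "(nat \<Rightarrow> 'a) \<Rightarrow> 'a trm \<Rightarrow> 'a" where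
  "val e (Var n) = e n"
| "val e (Par a) = a"

fun sat :: "('a \<Rightarrow> 'a \<Rightarrow> bool) \<Rightarrow> 'a set \<Rightarrow> (nat \<Rightarrow> 'a) \<Rightarrow> 'a fm \<Rightarrow> bool" where
  "sat E D e (FMem s t) = E (val e s) (val e t)"
| "sat E D e (FEq s t) = (val e s = val e t)"
| "sat E D e (FNeg \<phi>) = (\<not> sat E D e \<phi>)"
| "sat E D e (FAnd \<phi> \<psi>) = (sat E D e \<phi> \<and> sat E D e \<psi>)"
| "sat E D e (FEx n \<phi>) = (\<exists>x\<in>D. sat E D (e(n := x)) \<phi>)"
| "sat E D e (FAll n \<phi>) = (\<forall>x\<in>D. sat E D (e(n := x)) \<phi>)"

text \<open>
  Only used for sentences, whose truth value does not depend on the assignment. Assignments are not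
  required to take values in \<open>D\<close>, so that sentences are evaluated correctly in the empty structure.
\<close>

definition models :: "('a \<Rightarrow> 'a \<Rightarrow> bool) \<Rightarrow> 'a set \<Rightarrow> 'a fm \<Rightarrow> bool" where
  "models E D \<phi> \<longleftrightarrow> (\<forall>e. sat E D e \<phi>)"

definition ext :: "('a \<Rightarrow> 'a \<Rightarrow> bool) \<Rightarrow> 'a \<Rightarrow> 'a set" where
  "ext E A = {x. E x A}"

definition lang :: "('a \<Rightarrow> 'a \<Rightarrow> bool) \<Rightarrow> 'a \<Rightarrow> 'a fm set" where
  "lang E A = {\<phi>. fv \<phi> = {} \<and> params \<phi> \<subseteq> ext E A}"

inductive Delta0_fm :: "'a fm \<Rightarrow> bool" where
  "Delta0_fm (FMem s t)"
| "Delta0_fm (FEq s t)"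
| "Delta0_fm \<phi> \<Longrightarrow> Delta0_fm (FNeg \<phi>)"
| "Delta0_fm \<phi> \<Longrightarrow> Delta0_fm \<psi> \<Longrightarrow> Delta0_fm (FAnd \<phi> \<psi>)"
| "Delta0_fm \<phi> \<Longrightarrow> t \<noteq> Var n \<Longrightarrow> Delta0_fm (FEx n (FAnd (FMem (Var n) t) \<phi>))"
| "Delta0_fm \<phi> \<Longrightarrow> t \<noteq> Var n \<Longrightarrow> Delta0_fm (FAll n (FImp (FMem (Var n) t) \<phi>))"

inductive Sigma_fm :: "nat \<Rightarrow> 'a fm \<Rightarrow> bool" and Pi_fm :: "nat \<Rightarrow> 'a fm \<Rightarrow> bool" where
  "Delta0_fm \<phi> \<Longrightarrow> Sigma_fm 0 \<phi>"
| "Delta0_fm \<phi> \<Longrightarrow> Pi_fm 0 \<phi>"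
| "Pi_fm n \<phi> \<Longrightarrow> Sigma_fm (Suc n) \<phi>"
| "Sigma_fm (Suc n) \<phi> \<Longrightarrow> Sigma_fm (Suc n) (FEx k \<phi>)"
| "Sigma_fm n \<phi> \<Longrightarrow> Pi_fm (Suc n) \<phi>"
| "Pi_fm (Suc n) \<phi> \<Longrightarrow> Pi_fm (Suc n) (FAll k \<phi>)"

definition subset :: "('a \<Rightarrow> 'a \<Rightarrow> bool) \<Rightarrow> 'a \<Rightarrow> 'a \<Rightarrow> bool" where
  "subset E x y \<longleftrightarrow> (\<forall>z. E z x \<longrightarrow> E z y)"

locale ZFC =
  fixes E :: "'a \<Rightarrow> 'a \<Rightarrow> bool"
  assumes extensionality: "\<forall>x y. (\<forall>z. E z x \<longleftrightarrow> E z y) \<longrightarrow> x = y"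
    and foundation: "\<forall>x. (\<exists>y. E y x) \<longrightarrow> (\<exists>y. E y x \<and> (\<forall>z. E z x \<longrightarrow> \<not> E z y))"
    and pairing: "\<forall>x y. \<exists>z. \<forall>w. E w z \<longleftrightarrow> w = x \<or> w = y"
    and union: "\<forall>x. \<exists>u. \<forall>z. E z u \<longleftrightarrow> (\<exists>y. E y x \<and> E z y)"
    and power_set: "\<forall>x. \<exists>p. \<forall>z. E z p \<longleftrightarrow> subset E z x"
    and infinity: "\<exists>w. (\<exists>z. E z w \<and> (\<forall>x. \<not> E x z)) \<and>
      (\<forall>x. E x w \<longrightarrow> (\<exists>s. E s w \<and> (\<forall>z. E z s \<longleftrightarrow> E z x \<or> z = x)))"
    and choice: "\<forall>F. (\<forall>x. E x F \<longrightarrow> (\<exists>z. E z x)) \<and>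
      (\<forall>x y. E x F \<and> E y F \<and> x \<noteq> y \<longrightarrow> \<not> (\<exists>z. E z x \<and> E z y)) \<longrightarrow>
      (\<exists>c. \<forall>x. E x F \<longrightarrow> (\<exists>!z. E z x \<and> E z c))"
    and separation: "\<forall>\<phi> e a. \<exists>b. \<forall>x. E x b \<longleftrightarrow> E x a \<and> sat E UNIV (e(0 := x)) \<phi>"
    and replacement: "\<forall>\<phi> e a.
      (\<forall>x y z. E x a \<and> sat E UNIV (e(0 := x, 1 := y)) \<phi> \<and> sat E UNIV (e(0 := x, 1 := z)) \<phi>
        \<longrightarrow> y = z) \<longrightarrow>
      (\<exists>b. \<forall>y. E y b \<longleftrightarrow> (\<exists>x. E x a \<and> sat E UNIV (e(0 := x, 1 := y)) \<phi>))"

definition trans_set :: "('a \<Rightarrow> 'a \<Rightarrow> bool) \<Rightarrow> 'a \<Rightarrow> bool" where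
  "trans_set E x \<longleftrightarrow> (\<forall>y. E y x \<longrightarrow> subset E y x)"

definition is_ordinal :: "('a \<Rightarrow> 'a \<Rightarrow> bool) \<Rightarrow> 'a \<Rightarrow> bool" where
  "is_ordinal E \<alpha> \<longleftrightarrow> trans_set E \<alpha> \<and> (\<forall>\<beta>. E \<beta> \<alpha> \<longrightarrow> trans_set E \<beta>)"

definition is_upair :: "('a \<Rightarrow> 'a \<Rightarrow> bool) \<Rightarrow> 'a \<Rightarrow> 'a \<Rightarrow> 'a \<Rightarrow> bool" where
  "is_upair E x y z \<longleftrightarrow> (\<forall>w. E w z \<longleftrightarrow> w = x \<or> w = y)"

definition is_opair :: "('a \<Rightarrow> 'a \<Rightarrow> bool) \<Rightarrow> 'a \<Rightarrow> 'a \<Rightarrow> 'a \<Rightarrow> bool" where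
  "is_opair E x y p \<longleftrightarrow> (\<exists>a b. is_upair E x x a \<and> is_upair E x y b \<and> is_upair E a b p)"

definition maps_to :: "('a \<Rightarrow> 'a \<Rightarrow> bool) \<Rightarrow> 'a \<Rightarrow> 'a \<Rightarrow> 'a \<Rightarrow> bool" where
  "maps_to E f x y \<longleftrightarrow> (\<exists>p. E p f \<and> is_opair E x y p)"

definition is_function :: "('a \<Rightarrow> 'a \<Rightarrow> bool) \<Rightarrow> 'a \<Rightarrow> 'a \<Rightarrow> bool" where
  "is_function E f d \<longleftrightarrow>
     (\<forall>p. E p f \<longrightarrow> (\<exists>x y. E x d \<and> is_opair E x y p)) \<and>
     (\<forall>x. E x d \<longrightarrow> (\<exists>!y. maps_to E f x y))"

definition is_bijection :: "('a \<Rightarrow> 'a \<Rightarrow> bool) \<Rightarrow> 'a \<Rightarrow> 'a \<Rightarrow> 'a \<Rightarrow> bool" where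
  "is_bijection E f a b \<longleftrightarrow> is_function E f a \<and>
     (\<forall>x y. maps_to E f x y \<longrightarrow> E y b) \<and>
     (\<forall>y. E y b \<longrightarrow> (\<exists>!x. maps_to E f x y))"

definition is_cardinal :: "('a \<Rightarrow> 'a \<Rightarrow> bool) \<Rightarrow> 'a \<Rightarrow> bool" where
  "is_cardinal E \<kappa> \<longleftrightarrow> is_ordinal E \<kappa> \<and> (\<forall>\<beta>. E \<beta> \<kappa> \<longrightarrow> \<not> (\<exists>f. is_bijection E f \<beta> \<kappa>))"

definition is_succ :: "('a \<Rightarrow> 'a \<Rightarrow> bool) \<Rightarrow> 'a \<Rightarrow> 'a \<Rightarrow> bool" where
  "is_succ E \<alpha> s \<longleftrightarrow> (\<forall>x. E x s \<longleftrightarrow> E x \<alpha> \<or> x = \<alpha>)"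

text \<open>
  \<open>v = V\<^sub>\<alpha>\<close>, where \<open>V\<^sub>\<beta>\<close> is the union of the power sets of the \<open>V\<^sub>\<gamma>\<close>, \<open>\<gamma> < \<beta>\<close>; the recursion is witnessed by
  a function \<open>f\<close> on \<open>\<alpha> + 1\<close> that is an element of the model.
\<close>

definition is_V :: "('a \<Rightarrow> 'a \<Rightarrow> bool) \<Rightarrow> 'a \<Rightarrow> 'a \<Rightarrow> bool" where
  "is_V E \<alpha> v \<longleftrightarrow> is_ordinal E \<alpha> \<and>
     (\<exists>f s. is_succ E \<alpha> s \<and> is_function E f s \<and>
        (\<forall>\<beta> u. maps_to E f \<beta> u \<longrightarrow>
           (\<forall>x. E x u \<longleftrightarrow> (\<exists>\<gamma> w. E \<gamma> \<beta> \<and> maps_to E f \<gamma> w \<and> subset E x w))) \<and>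
        maps_to E f \<alpha> v)"

definition Sigma_elementary :: "('a \<Rightarrow> 'a \<Rightarrow> bool) \<Rightarrow> nat \<Rightarrow> 'a \<Rightarrow> bool" where
  "Sigma_elementary E n A \<longleftrightarrow>
     (\<forall>\<phi>\<in>lang E A. Sigma_fm n \<phi> \<longrightarrow> (models E (ext E A) \<phi> \<longleftrightarrow> models E UNIV \<phi>))"

definition Sigma_correct_cardinal :: "('a \<Rightarrow> 'a \<Rightarrow> bool) \<Rightarrow> nat \<Rightarrow> 'a \<Rightarrow> bool" where
  "Sigma_correct_cardinal E n \<delta> \<longleftrightarrow>
     is_cardinal E \<delta> \<and> (\<exists>v. is_V E \<delta> v \<and> Sigma_elementary E n v)"

text \<open>
  Modal formulas over a type of atoms: \<open>nat modal\<close> are the propositional modal formulas, and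
  \<open>map_modal \<sigma> p :: 'a fm modal\<close> is the instance of \<open>p\<close> under the substitution \<open>\<sigma> :: nat \<Rightarrow> 'a fm\<close>.
\<close>

datatype 'p modal =
    Atom 'p
  | MBot
  | MImp "'p modal" "'p modal"
  | Box "'p modal"
  | Dia "'p modal"

definition MNeg :: "'p modal \<Rightarrow> 'p modal" where
  "MNeg p = MImp p MBot"

fun bool_eval :: "('p modal \<Rightarrow> bool) \<Rightarrow> 'p modal \<Rightarrow> bool" where
  "bool_eval v (Atom a) = v (Atom a)"
| "bool_eval v MBot = False"
| "bool_eval v (MImp p q) = (bool_eval v p \<longrightarrow> bool_eval v q)"
| "bool_eval v (Box p) = v (Box p)"
| "bool_eval v (Dia p) = v (Dia p)"

definition tautology :: "'p modal \<Rightarrow> bool" where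
  "tautology p \<longleftrightarrow> (\<forall>v. bool_eval v p)"

inductive_set S5 :: "nat modal set" where
  taut: "tautology p \<Longrightarrow> p \<in> S5"
| K: "MImp (Box (MImp p q)) (MImp (Box p) (Box q)) \<in> S5"
| Dual1: "MImp (Dia p) (MNeg (Box (MNeg p))) \<in> S5"
| Dual2: "MImp (MNeg (Box (MNeg p))) (Dia p) \<in> S5"
| T: "MImp (Box p) p \<in> S5"
| Four: "MImp (Box p) (Box (Box p)) \<in> S5"
| Five: "MImp (Dia (Box p)) p \<in> S5"
| MP: "MImp p q \<in> S5 \<Longrightarrow> p \<in> S5 \<Longrightarrow> q \<in> S5"
| Nec: "p \<in> S5 \<Longrightarrow> Box p \<in> S5"

fun true_at :: "('a \<Rightarrow> 'a \<Rightarrow> bool) \<Rightarrow> 'a \<Rightarrow> 'a fm modal \<Rightarrow> bool" where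
  "true_at E W (Atom \<phi>) = models E (ext E W) \<phi>"
| "true_at E W MBot = False"
| "true_at E W (MImp p q) = (true_at E W p \<longrightarrow> true_at E W q)"
| "true_at E W (Box p) = (\<forall>U. trans_set E U \<and> subset E W U \<longrightarrow> true_at E U p)"
| "true_at E W (Dia p) = (\<exists>U. trans_set E U \<and> subset E W U \<and> true_at E U p)"

definition Val :: "('a \<Rightarrow> 'a \<Rightarrow> bool) \<Rightarrow> 'a \<Rightarrow> 'a fm set \<Rightarrow> nat modal set" where
  "Val E M L = {p. \<forall>\<sigma>. range \<sigma> \<subseteq> L \<longrightarrow> true_at E M (map_modal \<sigma> p)}"

end

theory Submission
  imports Defs "HOL-Combinatorics.Transposition"
begin

text \<open>
  A true \<open>\<Sigma>\<^sub>2\<close> assertion and the negation of a false \<open>\<Pi>\<^sub>1\<close> assertion hold in all sufficiently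
  large transitive sets, so the axiom \<open>\<diamond>\<box>p \<rightarrow> p\<close> at \<open>M\<close> makes \<open>M\<close> decide them correctly, and \<open>M\<close>
  is \<open>\<Sigma>\<^sub>2\<close>-elementary. Conversely ``some \<open>W\<close> is such that \<open>\<phi>\<close> holds in every transitive \<open>U \<supseteq> W\<close>'' is
  \<open>\<Sigma>\<^sub>2\<close>, so for \<open>\<Sigma>\<^sub>2\<close>-elementary \<open>M\<close> such a \<open>W\<close> exists in \<open>M\<close>: what holds in all large worlds holds
  in all worlds above \<open>M\<close>. Boxed assertions are then constant above \<open>M\<close>, and S5 is valid. A
  transitive \<open>\<Sigma>\<^sub>2\<close>-elementary \<open>M\<close> contains the power set, the rank and the \<open>V\<^sub>\<alpha>\<close> of its elements, so
  it is \<open>V\<^sub>\<delta>\<close> with \<open>\<delta> = M \<inter> Ord\<close>.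

  Formulas outside S5 are refuted at every \<open>M\<close>: they fail in a finite universal Kripke model, and
  the worlds of that model are simulated by a statement about the top of the current world whose
  value can be reset to any number by passing to a larger world.
\<close>

section \<open>Completeness of S5 for finite universal models\<close>

text \<open>The worlds of the universal model are valuations, so a model is a set \<open>T\<close> of valuations.\<close>

fun kripke_sat :: "('p \<Rightarrow> bool) set \<Rightarrow> ('p \<Rightarrow> bool) \<Rightarrow> 'p modal \<Rightarrow> bool" where
  "kripke_sat T v (Atom n) = v n"
| "kripke_sat T v MBot = False"
| "kripke_sat T v (MImp p q) = (kripke_sat T v p \<longrightarrow> kripke_sat T v q)"
| "kripke_sat T v (Box p) = (\<forall>u\<in>T. kripke_sat T u p)"
| "kripke_sat T v (Dia p) = (\<exists>u\<in>T. kripke_sat T u p)"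

inductive S5_derives :: "nat modal set \<Rightarrow> nat modal \<Rightarrow> bool" for G where
  assumption: "p \<in> G \<Longrightarrow> S5_derives G p"
| S5_theorem: "p \<in> S5 \<Longrightarrow> S5_derives G p"
| modus_ponens: "S5_derives G (MImp p q) \<Longrightarrow> S5_derives G p \<Longrightarrow> S5_derives G q"

lemma S5_derives_tautology: "tautology p \<Longrightarrow> S5_derives G p"
  by (intro S5_derives.S5_theorem S5.taut)

lemma S5_derives_mono: "S5_derives G p \<Longrightarrow> G \<subseteq> H \<Longrightarrow> S5_derives H p"
proof (induction rule: S5_derives.induct)
  case (modus_ponens p q)
  then show ?case by (auto intro: S5_derives.modus_ponens[of _ p])
qed (auto intro: S5_derives.assumption S5_derives.S5_theorem)

lemma S5_derives_empty: "S5_derives {} p \<Longrightarrow> p \<in> S5"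
proof (induction rule: S5_derives.induct)
  case (modus_ponens p q)
  show ?case by (rule S5.MP[OF modus_ponens.IH])
qed auto

lemma S5_deduction: "S5_derives (insert q G) p \<Longrightarrow> S5_derives G (MImp q p)"
proof (induction rule: S5_derives.induct)
  case (assumption p)
  show ?case
  proof (cases "p = q")
    case True
    then show ?thesis by (auto intro!: S5_derives_tautology simp: tautology_def)
  next
    case False
    with assumption have "S5_derives G p" by (auto intro: S5_derives.assumption)
    moreover have "S5_derives G (MImp p (MImp q p))"
      by (auto intro!: S5_derives_tautology simp: tautology_def)
    ultimately show ?thesis by (rule S5_derives.modus_ponens[rotated])
  qed
next
  case (S5_theorem p)
  have "S5_derives G (MImp p (MImp q p))"
    by (auto intro!: S5_derives_tautology simp: tautology_def)
  from S5_derives.modus_ponens[OF this S5_derives.S5_theorem[OF S5_theorem]] show ?case .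
next
  case (modus_ponens p r)
  have "S5_derives G (MImp (MImp q (MImp p r)) (MImp (MImp q p) (MImp q r)))"
    by (auto intro!: S5_derives_tautology simp: tautology_def)
  from S5_derives.modus_ponens[OF this modus_ponens.IH(1)]
  show ?case using modus_ponens.IH(2) by (rule S5_derives.modus_ponens)
qed

lemma S5_derives_by_contradiction:
  assumes "S5_derives (insert (MNeg p) G) MBot"
  shows "S5_derives G p"
proof (rule S5_derives.modus_ponens)
  show "S5_derives G (MImp (MImp (MNeg p) MBot) p)"
    by (auto intro!: S5_derives_tautology simp: tautology_def MNeg_def)
  show "S5_derives G (MImp (MNeg p) MBot)" using assms by (rule S5_deduction)
qed

lemma S5_derives_necessitation: "S5_derives {p. Box p \<in> G} q \<Longrightarrow> S5_derives G (Box q)"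
proof (induction rule: S5_derives.induct)
  case (modus_ponens p q)
  have "S5_derives G (MImp (Box (MImp p q)) (MImp (Box p) (Box q)))"
    by (rule S5_derives.S5_theorem[OF S5.K])
  from S5_derives.modus_ponens[OF this modus_ponens.IH(1)]
  show ?case using modus_ponens.IH(2) by (rule S5_derives.modus_ponens)
qed (auto intro: S5_derives.assumption S5_derives.S5_theorem S5.Nec)

lemma S5_derives_finite: "S5_derives G p \<Longrightarrow> \<exists>F\<subseteq>G. finite F \<and> S5_derives F p"
proof (induction rule: S5_derives.induct)
  case (assumption p)
  then show ?case by (intro exI[of _ "{p}"]) (auto intro: S5_derives.assumption)
next
  case (S5_theorem p)
  then show ?case by (intro exI[of _ "{}"]) (auto intro: S5_derives.S5_theorem)
next
  case (modus_ponens p q)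
  then obtain F F' where "F \<subseteq> G" "finite F" "S5_derives F (MImp p q)"
    and "F' \<subseteq> G" "finite F'" "S5_derives F' p" by blast
  then show ?case
    by (intro exI[of _ "F \<union> F'"])
      (auto intro: S5_derives.modus_ponens[of _ p] S5_derives_mono[of F] S5_derives_mono[of F'])
qed

definition S5_consistent :: "nat modal set \<Rightarrow> bool" where
  "S5_consistent G \<longleftrightarrow> \<not> S5_derives G MBot"

definition maximal_consistent :: "nat modal set \<Rightarrow> bool" where
  "maximal_consistent G \<longleftrightarrow> S5_consistent G \<and> (\<forall>p. S5_consistent (insert p G) \<longrightarrow> p \<in> G)"

lemma S5_consistent_Union_chain:
  assumes chain: "subset.chain {H. S5_consistent H} C" and "C \<noteq> {}"
  shows "S5_consistent (\<Union>C)"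
  unfolding S5_consistent_def
proof
  assume "S5_derives (\<Union>C) MBot"
  then obtain F where F: "finite F" "F \<subseteq> \<Union>C" "S5_derives F MBot" using S5_derives_finite by blast
  then obtain H where "H \<in> C" "F \<subseteq> H" using finite_subset_Union_chain assms by metis
  then have "S5_derives H MBot" using F(3) S5_derives_mono by blast
  with \<open>H \<in> C\<close> chain show False unfolding subset.chain_def S5_consistent_def by blast
qed

lemma lindenbaum:
  assumes "S5_consistent G"
  obtains H where "G \<subseteq> H" "maximal_consistent H"
proof -
  define consistent_extensions where "consistent_extensions = {H. G \<subseteq> H \<and> S5_consistent H}"
  have "\<exists>H\<in>consistent_extensions. \<forall>K\<in>consistent_extensions. H \<subseteq> K \<longrightarrow> K = H"
  proof (rule subset_Zorn_nonempty)
    show "consistent_extensions \<noteq> {}" using assms by (auto simp: consistent_extensions_def)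
  next
    fix C assume "C \<noteq> {}" and chain: "subset.chain consistent_extensions C"
    then have "subset.chain {H. S5_consistent H} C"
      by (auto simp: subset.chain_def consistent_extensions_def)
    then have "S5_consistent (\<Union>C)" using \<open>C \<noteq> {}\<close> by (rule S5_consistent_Union_chain)
    moreover have "G \<subseteq> \<Union>C"
      using chain \<open>C \<noteq> {}\<close> by (fastforce simp: subset.chain_def consistent_extensions_def)
    ultimately show "\<Union>C \<in> consistent_extensions" by (simp add: consistent_extensions_def)
  qed
  then obtain H where H: "G \<subseteq> H" "S5_consistent H"
    and maximal: "\<And>K. G \<subseteq> K \<Longrightarrow> S5_consistent K \<Longrightarrow> H \<subseteq> K \<Longrightarrow> K = H"
    by (auto simp: consistent_extensions_def)
  have "p \<in> H" if "S5_consistent (insert p H)" for p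
    using maximal[of "insert p H"] that H(1) by blast
  with H show thesis by (intro that[of H]) (simp_all add: maximal_consistent_def)
qed

lemma maximal_consistent_derives:
  assumes "maximal_consistent G" and "S5_derives G p"
  shows "p \<in> G"
proof -
  have "S5_consistent (insert p G)"
    using assms S5_derives.modus_ponens[OF S5_deduction assms(2)]
    unfolding maximal_consistent_def S5_consistent_def by blast
  then show ?thesis using assms(1) by (simp add: maximal_consistent_def)
qed

lemma maximal_consistent_S5: "maximal_consistent G \<Longrightarrow> p \<in> S5 \<Longrightarrow> p \<in> G"
  by (simp add: maximal_consistent_derives S5_derives.S5_theorem)

lemma maximal_consistent_MBot: "maximal_consistent G \<Longrightarrow> MBot \<notin> G"
  unfolding maximal_consistent_def S5_consistent_def using S5_derives.assumption by blast

lemma maximal_consistent_modus_ponens: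
  "maximal_consistent G \<Longrightarrow> MImp p q \<in> G \<Longrightarrow> p \<in> G \<Longrightarrow> q \<in> G"
  by (rule maximal_consistent_derives)
    (auto intro: S5_derives.modus_ponens[of _ p] S5_derives.assumption)

lemma maximal_consistent_MNeg:
  assumes "maximal_consistent G"
  shows "MNeg p \<in> G \<longleftrightarrow> p \<notin> G"
proof
  show "MNeg p \<in> G \<Longrightarrow> p \<notin> G"
    unfolding MNeg_def
    using assms maximal_consistent_modus_ponens[of G p MBot] maximal_consistent_MBot by blast
next
  assume "p \<notin> G"
  then have "S5_derives (insert p G) MBot"
    using assms unfolding maximal_consistent_def S5_consistent_def by blast
  with assms show "MNeg p \<in> G"
    unfolding MNeg_def by (intro maximal_consistent_derives S5_deduction)
qed

lemma maximal_consistent_MImp: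
  assumes G: "maximal_consistent G"
  shows "MImp p q \<in> G \<longleftrightarrow> (p \<in> G \<longrightarrow> q \<in> G)"
proof
  assume "p \<in> G \<longrightarrow> q \<in> G"
  then consider (refuted) "MNeg p \<in> G" | (proved) "q \<in> G"
    using maximal_consistent_MNeg[OF G] by blast
  then show "MImp p q \<in> G"
  proof cases
    case refuted
    have "MImp (MNeg p) (MImp p q) \<in> G"
      by (auto intro!: maximal_consistent_S5[OF G] S5.taut simp: tautology_def MNeg_def)
    then show ?thesis using refuted by (rule maximal_consistent_modus_ponens[OF G])
  next
    case proved
    have "MImp q (MImp p q) \<in> G"
      by (auto intro!: maximal_consistent_S5[OF G] S5.taut simp: tautology_def)
    then show ?thesis using proved by (rule maximal_consistent_modus_ponens[OF G])
  qed
qed (use maximal_consistent_modus_ponens[OF G] in blast)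

lemma maximal_consistent_Dia:
  assumes G: "maximal_consistent G"
  shows "Dia p \<in> G \<longleftrightarrow> Box (MNeg p) \<notin> G"
  using maximal_consistent_S5[OF G S5.Dual1[of p]] maximal_consistent_S5[OF G S5.Dual2[of p]]
  by (auto simp: maximal_consistent_MImp[OF G] maximal_consistent_MNeg[OF G])

definition canonical_cluster :: "nat modal set \<Rightarrow> nat modal set set" where
  "canonical_cluster G = {H. maximal_consistent H \<and> (\<forall>p. Box p \<in> H \<longleftrightarrow> Box p \<in> G)}"

lemma canonical_clusterI:
  assumes G: "maximal_consistent G" and H: "maximal_consistent H" and sub: "{p. Box p \<in> G} \<subseteq> H"
  shows "H \<in> canonical_cluster G"
proof -
  have "Box p \<in> H \<longleftrightarrow> Box p \<in> G" for p
  proof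
    assume "Box p \<in> G"
    then have "Box (Box p) \<in> G"
      by (rule maximal_consistent_modus_ponens[OF G maximal_consistent_S5[OF G S5.Four]])
    then show "Box p \<in> H" using sub by blast
  next
    assume "Box p \<in> H"
    then have "Box (Box p) \<in> H"
      by (rule maximal_consistent_modus_ponens[OF H maximal_consistent_S5[OF H S5.Four]])
    then have "Box (MNeg (Box (Box p))) \<notin> G" using sub maximal_consistent_MNeg[OF H] by blast
    then have "Dia (Box (Box p)) \<in> G" by (simp add: maximal_consistent_Dia[OF G])
    then show "Box p \<in> G"
      by (rule maximal_consistent_modus_ponens[OF G maximal_consistent_S5[OF G S5.Five]])
  qed
  then show ?thesis using H unfolding canonical_cluster_def by blast
qed

lemma canonical_cluster_Box:
  assumes H: "H \<in> canonical_cluster G"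
  shows "Box p \<in> H \<longleftrightarrow> (\<forall>K\<in>canonical_cluster G. p \<in> K)"
proof
  assume "Box p \<in> H"
  then have "Box p \<in> K \<and> maximal_consistent K" if "K \<in> canonical_cluster G" for K
    using that H unfolding canonical_cluster_def by blast
  then show "\<forall>K\<in>canonical_cluster G. p \<in> K"
    using maximal_consistent_modus_ponens[OF _ maximal_consistent_S5[OF _ S5.T]] by blast
next
  assume everywhere: "\<forall>K\<in>canonical_cluster G. p \<in> K"
  have maximal: "maximal_consistent H" using H unfolding canonical_cluster_def by blast
  show "Box p \<in> H"
  proof (rule ccontr)
    assume "Box p \<notin> H"
    then have "\<not> S5_derives {q. Box q \<in> H} p"
      using maximal S5_derives_necessitation maximal_consistent_derives by blast
    then have "S5_consistent (insert (MNeg p) {q. Box q \<in> H})"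
      unfolding S5_consistent_def using S5_derives_by_contradiction by blast
    then obtain K where K: "insert (MNeg p) {q. Box q \<in> H} \<subseteq> K" "maximal_consistent K"
      by (rule lindenbaum)
    then have "K \<in> canonical_cluster H" by (intro canonical_clusterI[OF maximal]) auto
    then have "K \<in> canonical_cluster G" using H unfolding canonical_cluster_def by simp
    moreover have "p \<notin> K" using K maximal_consistent_MNeg[OF K(2)] by blast
    ultimately show False using everywhere by blast
  qed
qed

definition canonical_valuation :: "nat modal set \<Rightarrow> nat \<Rightarrow> bool" where
  "canonical_valuation H n \<longleftrightarrow> Atom n \<in> H"

lemma kripke_sat_canonical:
  "H \<in> canonical_cluster G \<Longrightarrow>
    kripke_sat (canonical_valuation ` canonical_cluster G) (canonical_valuation H) p \<longleftrightarrow> p \<in> H"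
proof (induction p arbitrary: H)
  case (Atom n)
  show ?case by (simp add: canonical_valuation_def)
next
  case MBot
  then show ?case using maximal_consistent_MBot by (simp add: canonical_cluster_def)
next
  case (MImp p q)
  then show ?case using maximal_consistent_MImp by (simp add: canonical_cluster_def)
next
  case (Box p)
  then show ?case by (simp add: canonical_cluster_Box)
next
  case (Dia p)
  have "Dia p \<in> H \<longleftrightarrow> (\<exists>K\<in>canonical_cluster G. MNeg p \<notin> K)"
    using canonical_cluster_Box[OF Dia.prems, of "MNeg p"] Dia.prems maximal_consistent_Dia
    unfolding canonical_cluster_def by blast
  also have "\<dots> \<longleftrightarrow> (\<exists>K\<in>canonical_cluster G. p \<in> K)"
    by (auto simp: maximal_consistent_MNeg canonical_cluster_def)
  finally show ?case using Dia.IH by simp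
qed

lemma S5_complete:
  assumes "p \<notin> S5"
  shows "\<exists>T v. v \<in> T \<and> \<not> kripke_sat T v p"
proof -
  have "S5_consistent {MNeg p}"
    unfolding S5_consistent_def
    using assms S5_derives_by_contradiction[of p "{}"] S5_derives_empty by blast
  then obtain G where G: "{MNeg p} \<subseteq> G" "maximal_consistent G" by (rule lindenbaum)
  then have "p \<notin> G" using maximal_consistent_MNeg by blast
  have cluster: "G \<in> canonical_cluster G" using G(2) by (simp add: canonical_cluster_def)
  with \<open>p \<notin> G\<close>
  have "\<not> kripke_sat (canonical_valuation ` canonical_cluster G) (canonical_valuation G) p"
    by (simp add: kripke_sat_canonical)
  with cluster show ?thesis by blast
qed

lemma kripke_sat_restrict:
  assumes "set_modal p \<subseteq> A"
  shows "kripke_sat ((\<lambda>u n. n \<in> A \<and> u n) ` T) (\<lambda>n. n \<in> A \<and> v n) p \<longleftrightarrow> kripke_sat T v p"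
  using assms by (induction p arbitrary: v) auto

lemma finite_restricted_valuations:
  assumes "finite A"
  shows "finite (range (\<lambda>(u :: 'p \<Rightarrow> bool) n. n \<in> A \<and> u n))"
proof -
  have "range (\<lambda>u n. n \<in> A \<and> u n) \<subseteq> (\<lambda>X n. n \<in> X) ` Pow A"
  proof (intro image_subsetI image_eqI)
    show "(\<lambda>n. n \<in> A \<and> u n) = (\<lambda>n. n \<in> {n \<in> A. u n})" for u by simp
  qed auto
  then show ?thesis using assms by (meson finite_Pow_iff finite_imageI finite_subset)
qed

lemma S5_complete_finite:
  assumes "p \<notin> S5"
  shows "\<exists>T v. finite T \<and> v \<in> T \<and> \<not> kripke_sat T v p"
proof -
  obtain T v where T: "v \<in> T" "\<not> kripke_sat T v p" using S5_complete[OF assms] by blast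
  define restrict where "restrict = (\<lambda>(u :: nat \<Rightarrow> bool) n. n \<in> set_modal p \<and> u n)"
  have "finite (set_modal p)" by simp
  then have "finite (restrict ` T)"
    unfolding restrict_def
    by (rule finite_subset[OF image_mono finite_restricted_valuations, rotated]) simp
  moreover have "\<not> kripke_sat (restrict ` T) (restrict v) p"
    using T(2) kripke_sat_restrict[OF order_refl, of p T v] by (simp add: restrict_def)
  ultimately show ?thesis using T(1) by blast
qed

section \<open>First-order formulas\<close>

lemma finite_fv: "finite (fv \<phi>)"
proof (induction \<phi>)
  case (FMem t u)
  then show ?case by (cases t; cases u) auto
next
  case (FEq t u)
  then show ?case by (cases t; cases u) auto
qed auto

lemma val_cong: "(\<And>n. n \<in> fv_trm t \<Longrightarrow> e n = e' n) \<Longrightarrow> val e t = val e' t"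
  by (cases t) auto

lemma val_upd_other: "t \<noteq> Var n \<Longrightarrow> val (e(n := x)) t = val e t"
  by (cases t) auto

lemma sat_cong: "(\<And>n. n \<in> fv \<phi> \<Longrightarrow> e n = e' n) \<Longrightarrow> sat E D e \<phi> = sat E D e' \<phi>"
proof (induction \<phi> arbitrary: e e')
  case (FMem t u)
  then show ?case using val_cong[of t e e'] val_cong[of u e e'] by simp
next
  case (FEq t u)
  then show ?case using val_cong[of t e e'] val_cong[of u e e'] by simp
next
  case (FNeg \<phi>)
  have "sat E D e \<phi> = sat E D e' \<phi>" by (rule FNeg.IH) (simp add: FNeg.prems)
  then show ?case by simp
next
  case (FAnd \<phi> \<psi>)
  have "sat E D e \<phi> = sat E D e' \<phi>" by (rule FAnd.IH) (simp add: FAnd.prems)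
  moreover have "sat E D e \<psi> = sat E D e' \<psi>" by (rule FAnd.IH) (simp add: FAnd.prems)
  ultimately show ?case by simp
next
  case (FEx n \<phi>)
  have "sat E D (e(n := x)) \<phi> = sat E D (e'(n := x)) \<phi>" for x
    by (rule FEx.IH) (simp add: FEx.prems)
  then show ?case by simp
next
  case (FAll n \<phi>)
  have "sat E D (e(n := x)) \<phi> = sat E D (e'(n := x)) \<phi>" for x
    by (rule FAll.IH) (simp add: FAll.prems)
  then show ?case by simp
qed

lemma models_iff_sat: "fv \<phi> = {} \<Longrightarrow> models E D \<phi> \<longleftrightarrow> sat E D e \<phi>"
  unfolding models_def using sat_cong[of \<phi>] by blast

lemma models_FNeg: "fv \<phi> = {} \<Longrightarrow> models E D (FNeg \<phi>) \<longleftrightarrow> \<not> models E D \<phi>"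
  by (simp add: models_iff_sat[of _ E D undefined])

lemma models_FAnd: "models E D (FAnd \<phi> \<psi>) \<longleftrightarrow> models E D \<phi> \<and> models E D \<psi>"
  by (auto simp: models_def)

fun subst_trm :: "(nat \<Rightarrow> 'a trm) \<Rightarrow> 'a trm \<Rightarrow> 'a trm" where
  "subst_trm s (Var n) = s n"
| "subst_trm s (Par a) = Par a"

fun subst :: "(nat \<Rightarrow> nat) \<Rightarrow> (nat \<Rightarrow> 'a trm) \<Rightarrow> 'a fm \<Rightarrow> 'a fm" where
  "subst r s (FMem t u) = FMem (subst_trm s t) (subst_trm s u)"
| "subst r s (FEq t u) = FEq (subst_trm s t) (subst_trm s u)"
| "subst r s (FNeg \<phi>) = FNeg (subst r s \<phi>)"
| "subst r s (FAnd \<phi> \<psi>) = FAnd (subst r s \<phi>) (subst r s \<psi>)"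
| "subst r s (FEx n \<phi>) = FEx (r n) (subst r (s(n := Var (r n))) \<phi>)"
| "subst r s (FAll n \<phi>) = FAll (r n) (subst r (s(n := Var (r n))) \<phi>)"

text \<open>Bound variables are renamed by \<open>r\<close>, which therefore has to be injective.\<close>

definition capture_free :: "(nat \<Rightarrow> nat) \<Rightarrow> (nat \<Rightarrow> 'a trm) \<Rightarrow> bool" where
  "capture_free r s \<longleftrightarrow> inj r \<and> (\<forall>n. s n = Var (r n) \<or> (\<exists>a. s n = Par a))"

lemma capture_free_upd: "capture_free r s \<Longrightarrow> capture_free r (s(n := Var (r n)))"
  by (simp add: capture_free_def)

lemma capture_free_renaming: "inj r \<Longrightarrow> capture_free r (\<lambda>n. Var (r n))"
  by (simp add: capture_free_def)

lemma capture_free_closing: "capture_free id (\<lambda>n. Par (e n))"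
  by (simp add: capture_free_def)

lemma capture_free_eq: "capture_free r s \<Longrightarrow> s m = Var (r n) \<Longrightarrow> m = n"
  unfolding capture_free_def by (metis injD trm.distinct(1) trm.inject(1))

lemma val_subst_trm: "val e (subst_trm s t) = val (\<lambda>n. val e (s n)) t"
  by (cases t) auto

lemma val_capture_free_upd:
  assumes "capture_free r s"
  shows "(\<lambda>m. val (e(r n := x)) ((s(n := Var (r n))) m)) = (\<lambda>m. val e (s m))(n := x)"
proof
  fix m
  have "val (e(r n := x)) (s m) = val e (s m)" if "m \<noteq> n"
    using that capture_free_eq[OF assms, of m n] by (cases "s m") auto
  then show "val (e(r n := x)) ((s(n := Var (r n))) m) = ((\<lambda>m. val e (s m))(n := x)) m" by simp
qed

lemma sat_subst:
  "capture_free r s \<Longrightarrow> sat E D e (subst r s \<phi>) = sat E D (\<lambda>m. val e (s m)) \<phi>"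
proof (induction \<phi> arbitrary: e s)
  case (FEx n \<phi>)
  have "sat E D (e(r n := x)) (subst r (s(n := Var (r n))) \<phi>) =
      sat E D ((\<lambda>m. val e (s m))(n := x)) \<phi>" for x
    unfolding val_capture_free_upd[OF FEx.prems, symmetric]
    by (rule FEx.IH[OF capture_free_upd[OF FEx.prems]])
  then show ?case by simp
next
  case (FAll n \<phi>)
  have "sat E D (e(r n := x)) (subst r (s(n := Var (r n))) \<phi>) =
      sat E D ((\<lambda>m. val e (s m))(n := x)) \<phi>" for x
    unfolding val_capture_free_upd[OF FAll.prems, symmetric]
    by (rule FAll.IH[OF capture_free_upd[OF FAll.prems]])
  then show ?case by simp
qed (auto simp: val_subst_trm)

lemma fv_subst: "capture_free r s \<Longrightarrow> fv (subst r s \<phi>) \<subseteq> (\<Union>n\<in>fv \<phi>. fv_trm (s n))"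
proof (induction \<phi> arbitrary: s)
  case (FMem t u)
  then show ?case by (cases t; cases u) auto
next
  case (FEq t u)
  then show ?case by (cases t; cases u) auto
next
  case (FEx n \<phi>)
  have "fv (subst r (s(n := Var (r n))) \<phi>) \<subseteq> (\<Union>m\<in>fv \<phi>. fv_trm ((s(n := Var (r n))) m))"
    using FEx.prems by (intro FEx.IH capture_free_upd)
  then show ?case by (auto split: if_splits)
next
  case (FAll n \<phi>)
  have "fv (subst r (s(n := Var (r n))) \<phi>) \<subseteq> (\<Union>m\<in>fv \<phi>. fv_trm ((s(n := Var (r n))) m))"
    using FAll.prems by (intro FAll.IH capture_free_upd)
  then show ?case by (auto split: if_splits)
qed fastforce+

lemma params_subst: "params (subst r s \<phi>) \<subseteq> params \<phi> \<union> (\<Union>n\<in>fv \<phi>. set_trm (s n))"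
proof (induction \<phi> arbitrary: s)
  case (FMem t u)
  then show ?case by (cases t; cases u) auto
next
  case (FEq t u)
  then show ?case by (cases t; cases u) auto
next
  case (FEx n \<phi>)
  have "params (subst r (s(n := Var (r n))) \<phi>)
      \<subseteq> params \<phi> \<union> (\<Union>m\<in>fv \<phi>. set_trm ((s(n := Var (r n))) m))" by (rule FEx.IH)
  also have "\<dots> \<subseteq> params (FEx n \<phi>) \<union> (\<Union>m\<in>fv (FEx n \<phi>). set_trm (s m))"
    by (auto split: if_splits)
  finally show ?case by simp
next
  case (FAll n \<phi>)
  have "params (subst r (s(n := Var (r n))) \<phi>)
      \<subseteq> params \<phi> \<union> (\<Union>m\<in>fv \<phi>. set_trm ((s(n := Var (r n))) m))" by (rule FAll.IH)
  also have "\<dots> \<subseteq> params (FAll n \<phi>) \<union> (\<Union>m\<in>fv (FAll n \<phi>). set_trm (s m))"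
    by (auto split: if_splits)
  finally show ?case by simp
qed fastforce+

lemmas Delta0_fm_BEx = Delta0_fm.intros(5) and Delta0_fm_BAll = Delta0_fm.intros(6)

lemmas Delta0_fm_induct [consumes 1, case_names Mem Eq Neg And BEx BAll] = Delta0_fm.induct

lemmas Sigma_fm_FEx = Sigma_fm_Pi_fm.intros(4) and Pi_fm_FAll = Sigma_fm_Pi_fm.intros(6)

definition subst_closed :: "('a fm \<Rightarrow> bool) \<Rightarrow> bool" where
  "subst_closed K \<longleftrightarrow> (\<forall>r s \<phi>. capture_free r s \<and> K \<phi> \<longrightarrow> K (subst r s \<phi>))"

lemma subst_closed_Delta0: "subst_closed Delta0_fm"
proof -
  have "Delta0_fm (subst r s \<phi>)" if "Delta0_fm \<phi>" "capture_free r s" for r s and \<phi> :: "'a fm"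
    using that
  proof (induction \<phi> arbitrary: s rule: Delta0_fm_induct)
    case (BEx \<phi> t n)
    have "subst_trm (s(n := Var (r n))) t \<noteq> Var (r n)"
      using BEx.hyps(2) capture_free_eq[OF BEx.prems] by (cases t) auto
    with BEx.IH[OF capture_free_upd[OF BEx.prems]] show ?case
      unfolding subst.simps subst_trm.simps fun_upd_same by (rule Delta0_fm_BEx)
  next
    case (BAll \<phi> t n)
    have "subst_trm (s(n := Var (r n))) t \<noteq> Var (r n)"
      using BAll.hyps(2) capture_free_eq[OF BAll.prems] by (cases t) auto
    with BAll.IH[OF capture_free_upd[OF BAll.prems]] show ?case
      unfolding FImp_def subst.simps subst_trm.simps fun_upd_same
      by (rule Delta0_fm_BAll[unfolded FImp_def])
  qed (auto intro: Delta0_fm.intros)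
  then show ?thesis by (simp add: subst_closed_def)
qed

lemma Levy_subst:
  shows "Sigma_fm n \<phi> \<Longrightarrow> capture_free r s \<Longrightarrow> Sigma_fm n (subst r s \<phi>)"
    and "Pi_fm n \<phi> \<Longrightarrow> capture_free r s \<Longrightarrow> Pi_fm n (subst r s \<phi>)"
  by (induction arbitrary: s and s rule: Sigma_fm_Pi_fm.inducts)
    (use subst_closed_Delta0 in
      \<open>auto simp: subst_closed_def capture_free_upd intro: Sigma_fm_Pi_fm.intros\<close>)

lemma subst_closed_Sigma: "subst_closed (Sigma_fm n)"
  by (simp add: subst_closed_def Levy_subst)

lemma subst_closed_Pi: "subst_closed (Pi_fm n)"
  by (simp add: subst_closed_def Levy_subst)

text \<open>
  The shift \<open>n + 1 \<mapsto> n\<close> of the finitely many free variables is extended to an injection by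
  \<open>0 \<mapsto> k\<close> with \<open>k\<close> large.
\<close>

lemma ex_fresh_binder:
  assumes "finite N"
  shows "\<exists>k r. k \<notin> N \<and> inj r \<and>
    (\<forall>E D e x. sat E D (e(k := x)) (subst r (\<lambda>n. Var (r n)) \<phi>) \<longleftrightarrow> sat E D (case_nat x e) \<phi>)"
proof -
  obtain k where k: "\<And>n. n \<in> N \<union> fv \<phi> \<Longrightarrow> n < k"
    using assms finite_fv[of \<phi>] finite_nat_set_iff_bounded[of "N \<union> fv \<phi>"] by auto
  define r where "r n = (if n = 0 then k else if n \<le> k then n - 1 else n)" for n
  have "inj r" by (auto simp: inj_def r_def)
  moreover have "(e(k := x)) (r n) = case_nat x e n" if "n \<in> fv \<phi>" for e :: "nat \<Rightarrow> 'a" and x n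
    using k[of n] that by (cases n) (auto simp: r_def)
  then have "sat E D (e(k := x)) (subst r (\<lambda>n. Var (r n)) \<phi>) \<longleftrightarrow> sat E D (case_nat x e) \<phi>" for E D e x
    unfolding sat_subst[OF capture_free_renaming[OF \<open>inj r\<close>]] val.simps by (rule sat_cong)
  moreover have "k \<notin> N" using k by blast
  ultimately show ?thesis by blast
qed

definition close :: "(nat \<Rightarrow> 'a) \<Rightarrow> 'a fm \<Rightarrow> 'a fm" where
  "close e = subst id (\<lambda>n. Par (e n))"

lemma fv_close: "fv (close e \<phi>) = {}"
  unfolding close_def using fv_subst[OF capture_free_closing] by fastforce

lemma models_close: "models E D (close e \<phi>) \<longleftrightarrow> sat E D e \<phi>"
  unfolding models_iff_sat[OF fv_close, where e = undefined]
  by (simp add: close_def sat_subst capture_free_closing)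

lemma Sigma_fm_close: "Sigma_fm n \<phi> \<Longrightarrow> Sigma_fm n (close e \<phi>)"
  unfolding close_def by (rule Levy_subst(1)[OF _ capture_free_closing])

definition denotations :: "(nat \<Rightarrow> 'a) \<Rightarrow> 'a fm \<Rightarrow> 'a set" where
  "denotations e \<phi> = params \<phi> \<union> e ` fv \<phi>"

lemma finite_denotations: "finite (denotations e \<phi>)"
  by (simp add: denotations_def finite_fv)

lemma denotations_simps:
  "denotations e (FNeg \<phi>) = denotations e \<phi>"
  "denotations e (FAnd \<phi> \<psi>) = denotations e \<phi> \<union> denotations e \<psi>"
  by (auto simp: denotations_def)

lemma denotations_upd:
  "denotations (e(n := x)) \<phi> \<subseteq> insert x (denotations e (FEx n \<phi>))"
  "denotations (e(n := x)) \<phi> \<subseteq> insert x (denotations e (FAll n \<phi>))"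
  by (auto simp: denotations_def)

lemma params_close: "params (close e \<phi>) \<subseteq> denotations e \<phi>"
  unfolding close_def denotations_def
  using params_subst[of id "\<lambda>n. Par (e n)" \<phi>] by (simp add: UNION_singleton_eq_range)

lemma close_in_lang: "denotations e \<phi> \<subseteq> ext E A \<Longrightarrow> close e \<phi> \<in> lang E A"
  unfolding lang_def using params_close[of e \<phi>] fv_close[of e \<phi>] by blast

section \<open>Definability\<close>

text \<open>
  Assignments are read as de Bruijn environments, so that a predicate with a quantifier is definable
  if its body is definable in the extended environment.
\<close>

definition definable ::
  "('a \<Rightarrow> 'a \<Rightarrow> bool) \<Rightarrow> ('a fm \<Rightarrow> bool) \<Rightarrow> 'a set \<Rightarrow> ((nat \<Rightarrow> 'a) \<Rightarrow> bool) \<Rightarrow> bool" where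
  "definable E K A P \<longleftrightarrow> (\<exists>\<phi>. K \<phi> \<and> params \<phi> \<subseteq> A \<and> (\<forall>e. sat E UNIV e \<phi> \<longleftrightarrow> P e))"

abbreviation fo_definable :: "('a \<Rightarrow> 'a \<Rightarrow> bool) \<Rightarrow> ((nat \<Rightarrow> 'a) \<Rightarrow> bool) \<Rightarrow> bool" where
  "fo_definable E P \<equiv> definable E (\<lambda>_. True) UNIV P"

definition definable_term :: "'a set \<Rightarrow> ((nat \<Rightarrow> 'a) \<Rightarrow> 'a) \<Rightarrow> bool" where
  "definable_term A f \<longleftrightarrow> (\<exists>t. set_trm t \<subseteq> A \<and> f = (\<lambda>e. val e t))"

definition definable_rel ::
  "('a \<Rightarrow> 'a \<Rightarrow> bool) \<Rightarrow> ('a fm \<Rightarrow> bool) \<Rightarrow> 'a set \<Rightarrow> ('a \<Rightarrow> 'a \<Rightarrow> bool) \<Rightarrow> bool" where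
  "definable_rel E K A R \<longleftrightarrow>
    (\<forall>f g. definable_term A f \<and> definable_term A g \<longrightarrow> definable E K A (\<lambda>e. R (f e) (g e)))"

abbreviation fo_definable_rel :: "('a \<Rightarrow> 'a \<Rightarrow> bool) \<Rightarrow> ('a \<Rightarrow> 'a \<Rightarrow> bool) \<Rightarrow> bool" where
  "fo_definable_rel E R \<equiv> definable_rel E (\<lambda>_. True) UNIV R"

lemma definable_weaken:
  "definable E K A P \<Longrightarrow> (\<And>\<phi>. K \<phi> \<Longrightarrow> K' \<phi>) \<Longrightarrow> A \<subseteq> A' \<Longrightarrow> definable E K' A' P"
  unfolding definable_def by blast

lemma definable_Sigma_if_Pi: "definable E (Pi_fm n) A P \<Longrightarrow> definable E (Sigma_fm (Suc n)) A P"
  by (erule definable_weaken) (auto intro: Sigma_fm_Pi_fm.intros)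

lemma Levy_Delta0: "Delta0_fm \<phi> \<Longrightarrow> Sigma_fm n \<phi> \<and> Pi_fm n \<phi>"
  by (induction n) (auto intro: Sigma_fm_Pi_fm.intros)

lemma definable_Pi_if_Delta0: "definable E Delta0_fm A P \<Longrightarrow> definable E (Pi_fm n) A P"
  by (erule definable_weaken) (simp_all add: Levy_Delta0)

lemma definable_term_Var: "definable_term A (\<lambda>e. e i)"
  unfolding definable_term_def by (intro exI[of _ "Var i"]) auto

lemma definable_term_Par: "a \<in> A \<Longrightarrow> definable_term A (\<lambda>e. a)"
  unfolding definable_term_def by (intro exI[of _ "Par a"]) auto

lemma definable_term_shift:
  assumes "definable_term A f"
  shows "definable_term A (\<lambda>e. f (\<lambda>n. e (Suc n)))"
proof -
  obtain t where t: "set_trm t \<subseteq> A" "f = (\<lambda>e. val e t)"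
    using assms unfolding definable_term_def by blast
  then show ?thesis by (cases t) (auto intro: definable_term_Var definable_term_Par)
qed

lemmas definable_variables = definable_term_Var definable_term_shift

lemma definable_term_val:
  assumes "\<And>n. definable_term A (s n)" and "set_trm t \<subseteq> A"
  shows "definable_term A (\<lambda>e. val (\<lambda>n. s n e) t)"
  using assms by (cases t) (auto intro: definable_term_Par)

lemma definable_term_upd:
  assumes "\<And>n. definable_term A (s n)"
  shows "definable_term A (\<lambda>e. ((\<lambda>k. s k (\<lambda>n. e (Suc n)))(m := e 0)) n)"
  using assms by (cases "n = m") (simp_all add: definable_variables)

lemma definable_binderE:
  assumes "subst_closed K" and "definable E K A (\<lambda>e. P (\<lambda>n. e (Suc n)) (e 0))" and "finite N"
  obtains k \<phi> where "k \<notin> N" "K \<phi>" "params \<phi> \<subseteq> A" "\<And>e x. sat E UNIV (e(k := x)) \<phi> \<longleftrightarrow> P e x"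
proof -
  obtain \<phi> where \<phi>: "K \<phi>" "params \<phi> \<subseteq> A" "\<And>e. sat E UNIV e \<phi> \<longleftrightarrow> P (\<lambda>n. e (Suc n)) (e 0)"
    using assms(2) unfolding definable_def by blast
  obtain k r where "k \<notin> N" "inj r"
    and sat: "\<And>e x. sat E UNIV (e(k := x)) (subst r (\<lambda>n. Var (r n)) \<phi>) \<longleftrightarrow>
      sat E UNIV (case_nat x e) \<phi>"
    using ex_fresh_binder[OF assms(3), of \<phi>] by blast
  have "K (subst r (\<lambda>n. Var (r n)) \<phi>)"
    using assms(1) \<phi>(1) capture_free_renaming[OF \<open>inj r\<close>] unfolding subst_closed_def by blast
  moreover have "params (subst r (\<lambda>n. Var (r n)) \<phi>) \<subseteq> A"
    using \<phi>(2) params_subst[of r "\<lambda>n. Var (r n)" \<phi>] by auto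
  moreover have "sat E UNIV (e(k := x)) (subst r (\<lambda>n. Var (r n)) \<phi>) \<longleftrightarrow> P e x" for e x
    by (simp add: sat \<phi>(3))
  ultimately show thesis using \<open>k \<notin> N\<close> that by blast
qed

lemma definable_FEx:
  assumes "subst_closed K" and "\<And>k \<phi>. K \<phi> \<Longrightarrow> K (FEx k \<phi>)"
    and "definable E K A (\<lambda>e. P (\<lambda>n. e (Suc n)) (e 0))"
  shows "definable E K A (\<lambda>e. \<exists>x. P e x)"
proof -
  obtain k \<phi> where "K \<phi>" "params \<phi> \<subseteq> A" "\<And>e x. sat E UNIV (e(k := x)) \<phi> \<longleftrightarrow> P e x"
    using definable_binderE[OF assms(1,3) finite.emptyI] by metis
  then show ?thesis unfolding definable_def using assms(2) by (intro exI[of _ "FEx k \<phi>"]) simp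
qed

lemma definable_FAll:
  assumes "subst_closed K" and "\<And>k \<phi>. K \<phi> \<Longrightarrow> K (FAll k \<phi>)"
    and "definable E K A (\<lambda>e. P (\<lambda>n. e (Suc n)) (e 0))"
  shows "definable E K A (\<lambda>e. \<forall>x. P e x)"
proof -
  obtain k \<phi> where "K \<phi>" "params \<phi> \<subseteq> A" "\<And>e x. sat E UNIV (e(k := x)) \<phi> \<longleftrightarrow> P e x"
    using definable_binderE[OF assms(1,3) finite.emptyI] by metis
  then show ?thesis unfolding definable_def using assms(2) by (intro exI[of _ "FAll k \<phi>"]) simp
qed

lemma Sigma_definable_ex:
  "definable E (Sigma_fm (Suc n)) A (\<lambda>e. P (\<lambda>n. e (Suc n)) (e 0)) \<Longrightarrow>
    definable E (Sigma_fm (Suc n)) A (\<lambda>e. \<exists>x. P e x)"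
  by (rule definable_FEx[OF subst_closed_Sigma Sigma_fm_FEx])

lemma Pi_definable_all:
  "definable E (Pi_fm (Suc n)) A (\<lambda>e. P (\<lambda>n. e (Suc n)) (e 0)) \<Longrightarrow>
    definable E (Pi_fm (Suc n)) A (\<lambda>e. \<forall>x. P e x)"
  by (rule definable_FAll[OF subst_closed_Pi Pi_fm_FAll])

lemma fo_definable_ex:
  "fo_definable E (\<lambda>e. P (\<lambda>n. e (Suc n)) (e 0)) \<Longrightarrow> fo_definable E (\<lambda>e. \<exists>x. P e x)"
  by (rule definable_FEx) (simp_all add: subst_closed_def)

lemma fo_definable_all:
  "fo_definable E (\<lambda>e. P (\<lambda>n. e (Suc n)) (e 0)) \<Longrightarrow> fo_definable E (\<lambda>e. \<forall>x. P e x)"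
  by (rule definable_FAll) (simp_all add: subst_closed_def)

definition Delta0_closed :: "('a fm \<Rightarrow> bool) \<Rightarrow> bool" where
  "Delta0_closed K \<longleftrightarrow> subst_closed K \<and> (\<forall>t u. K (FMem t u) \<and> K (FEq t u)) \<and>
    (\<forall>\<phi>. K \<phi> \<longrightarrow> K (FNeg \<phi>)) \<and> (\<forall>\<phi> \<psi>. K \<phi> \<and> K \<psi> \<longrightarrow> K (FAnd \<phi> \<psi>)) \<and>
    (\<forall>n t \<phi>. K \<phi> \<and> t \<noteq> Var n \<longrightarrow> K (FEx n (FAnd (FMem (Var n) t) \<phi>)))"

lemma Delta0_closed_Delta0: "Delta0_closed Delta0_fm"
  unfolding Delta0_closed_def by (auto intro: Delta0_fm.intros subst_closed_Delta0)

lemma Delta0_closed_True: "Delta0_closed (\<lambda>_. True)"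
  by (simp add: Delta0_closed_def subst_closed_def)

context
  fixes K :: "'a fm \<Rightarrow> bool"
  assumes K: "Delta0_closed K"
begin

lemma definable_mem:
  assumes "definable_term A f" and "definable_term A g"
  shows "definable E K A (\<lambda>e. E (f e) (g e))"
proof -
  obtain t u where "set_trm t \<subseteq> A" "f = (\<lambda>e. val e t)" "set_trm u \<subseteq> A" "g = (\<lambda>e. val e u)"
    using assms unfolding definable_term_def by blast
  then show ?thesis
    unfolding definable_def using K by (intro exI[of _ "FMem t u"]) (simp add: Delta0_closed_def)
qed

lemma definable_eq:
  assumes "definable_term A f" and "definable_term A g"
  shows "definable E K A (\<lambda>e. f e = g e)"
proof -
  obtain t u where "set_trm t \<subseteq> A" "f = (\<lambda>e. val e t)" "set_trm u \<subseteq> A" "g = (\<lambda>e. val e u)"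
    using assms unfolding definable_term_def by blast
  then show ?thesis
    unfolding definable_def using K by (intro exI[of _ "FEq t u"]) (simp add: Delta0_closed_def)
qed

lemma definable_not:
  assumes "definable E K A P"
  shows "definable E K A (\<lambda>e. \<not> P e)"
proof -
  obtain \<phi> where "K \<phi>" "params \<phi> \<subseteq> A" "\<And>e. sat E UNIV e \<phi> \<longleftrightarrow> P e"
    using assms unfolding definable_def by blast
  then show ?thesis
    unfolding definable_def using K by (intro exI[of _ "FNeg \<phi>"]) (simp add: Delta0_closed_def)
qed

lemma definable_and:
  assumes "definable E K A P" and "definable E K A Q"
  shows "definable E K A (\<lambda>e. P e \<and> Q e)"
proof -
  obtain \<phi> where "K \<phi>" "params \<phi> \<subseteq> A" "\<And>e. sat E UNIV e \<phi> \<longleftrightarrow> P e"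
    using assms(1) unfolding definable_def by blast
  moreover obtain \<psi> where "K \<psi>" "params \<psi> \<subseteq> A" "\<And>e. sat E UNIV e \<psi> \<longleftrightarrow> Q e"
    using assms(2) unfolding definable_def by blast
  ultimately show ?thesis
    unfolding definable_def using K by (intro exI[of _ "FAnd \<phi> \<psi>"]) (simp add: Delta0_closed_def)
qed

lemma definable_or: "definable E K A P \<Longrightarrow> definable E K A Q \<Longrightarrow> definable E K A (\<lambda>e. P e \<or> Q e)"
  using definable_not[OF definable_and[OF definable_not definable_not], of E A P Q] by simp

lemma definable_imp: "definable E K A P \<Longrightarrow> definable E K A Q \<Longrightarrow> definable E K A (\<lambda>e. P e \<longrightarrow> Q e)"
  unfolding imp_conv_disj by (intro definable_or definable_not)

lemma definable_iff: "definable E K A P \<Longrightarrow> definable E K A Q \<Longrightarrow> definable E K A (\<lambda>e. P e \<longleftrightarrow> Q e)"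
  unfolding iff_conv_conj_imp by (intro definable_and definable_imp)

lemma definable_bex:
  assumes "definable_term A f" and "definable E K A (\<lambda>e. P (\<lambda>n. e (Suc n)) (e 0))"
  shows "definable E K A (\<lambda>e. \<exists>x. E x (f e) \<and> P e x)"
proof -
  obtain t where t: "set_trm t \<subseteq> A" "f = (\<lambda>e. val e t)"
    using assms(1) unfolding definable_term_def by blast
  have "subst_closed K" using K by (simp add: Delta0_closed_def)
  have "finite (fv_trm t)" by (cases t) auto
  obtain k \<phi> where \<phi>: "k \<notin> fv_trm t" "K \<phi>" "params \<phi> \<subseteq> A"
    "\<And>e x. sat E UNIV (e(k := x)) \<phi> \<longleftrightarrow> P e x"
    using definable_binderE[OF \<open>subst_closed K\<close> assms(2) \<open>finite (fv_trm t)\<close>] by metis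
  have "t \<noteq> Var k" using \<phi>(1) by auto
  then have "K (FEx k (FAnd (FMem (Var k) t) \<phi>))" using K \<phi>(2) by (simp add: Delta0_closed_def)
  then show ?thesis
    unfolding definable_def using t \<phi>(3,4) val_upd_other[OF \<open>t \<noteq> Var k\<close>]
    by (intro exI[of _ "FEx k (FAnd (FMem (Var k) t) \<phi>)"]) simp
qed

lemma definable_ball:
  assumes "definable_term A f" and "definable E K A (\<lambda>e. P (\<lambda>n. e (Suc n)) (e 0))"
  shows "definable E K A (\<lambda>e. \<forall>x. E x (f e) \<longrightarrow> P e x)"
  using definable_not[OF definable_bex[OF assms(1) definable_not[OF assms(2)]]] by simp

lemmas definable_connectives =
  definable_mem definable_eq definable_not definable_and definable_or definable_imp definable_iff
  definable_bex definable_ball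

lemma definable_relativized:
  assumes "definable_term A f" and "\<And>n. definable_term A (s n)" and "params \<phi> \<subseteq> A"
  shows "definable E K A (\<lambda>e. sat E (ext E (f e)) (\<lambda>n. s n e) \<phi>)"
  using assms
proof (induction \<phi> arbitrary: f s)
  case (FEx m \<phi>)
  have "definable E K A
      (\<lambda>e. sat E (ext E (f (\<lambda>n. e (Suc n)))) ((\<lambda>k. s k (\<lambda>n. e (Suc n)))(m := e 0)) \<phi>)"
    by (rule FEx.IH[where s = "\<lambda>n e. ((\<lambda>k. s k (\<lambda>n. e (Suc n)))(m := e 0)) n"])
      (use FEx.prems in
        \<open>auto intro: definable_term_shift definable_term_upd simp del: fun_upd_apply\<close>)
  from definable_bex[OF FEx.prems(1),
    where P = "\<lambda>e x. sat E (ext E (f e)) ((\<lambda>k. s k e)(m := x)) \<phi>", OF this]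
  show ?case by (simp add: ext_def Bex_def)
next
  case (FAll m \<phi>)
  have "definable E K A
      (\<lambda>e. sat E (ext E (f (\<lambda>n. e (Suc n)))) ((\<lambda>k. s k (\<lambda>n. e (Suc n)))(m := e 0)) \<phi>)"
    by (rule FAll.IH[where s = "\<lambda>n e. ((\<lambda>k. s k (\<lambda>n. e (Suc n)))(m := e 0)) n"])
      (use FAll.prems in
        \<open>auto intro: definable_term_shift definable_term_upd simp del: fun_upd_apply\<close>)
  from definable_ball[OF FAll.prems(1),
    where P = "\<lambda>e x. sat E (ext E (f e)) ((\<lambda>k. s k e)(m := x)) \<phi>", OF this]
  show ?case by (simp add: ext_def Ball_def)
qed (auto intro!: definable_connectives definable_term_val)

lemma definable_subset:
  "definable_term A f \<Longrightarrow> definable_term A g \<Longrightarrow> definable E K A (\<lambda>e. subset E (f e) (g e))"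
  unfolding subset_def by (intro definable_connectives definable_variables)

end

lemma definable_relI:
  assumes "\<And>f g. definable_term A f \<Longrightarrow> definable_term A g \<Longrightarrow> definable E K A (\<lambda>e. R (f e) (g e))"
  shows "definable_rel E K A R"
  using assms by (simp add: definable_rel_def)

lemma definable_relD:
  "definable_rel E K A R \<Longrightarrow> definable_term A f \<Longrightarrow> definable_term A g \<Longrightarrow>
    definable E K A (\<lambda>e. R (f e) (g e))"
  by (simp add: definable_rel_def)

lemma definable_rel_subset: "Delta0_closed K \<Longrightarrow> definable_rel E K A (subset E)"
  by (intro definable_relI definable_subset)

text \<open>The shift rule comes last: on a constant term it applies without making progress.\<close>

lemmas definable_terms = definable_term_Var definable_term_Par[OF UNIV_I] definable_term_shift

lemmas fo_definable_intros =
  definable_connectives[OF Delta0_closed_True] fo_definable_ex fo_definable_all definable_terms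

section \<open>Set theory in a model of ZFC\<close>

context ZFC
begin

lemma set_eqI: "(\<And>z. E z x \<longleftrightarrow> E z y) \<Longrightarrow> x = y"
  using extensionality by blast

definition small :: "('a \<Rightarrow> bool) \<Rightarrow> bool" where
  "small Q \<longleftrightarrow> (\<exists>s. \<forall>x. E x s \<longleftrightarrow> Q x)"

definition collect :: "('a \<Rightarrow> bool) \<Rightarrow> 'a" where
  "collect Q = (THE s. \<forall>x. E x s \<longleftrightarrow> Q x)"

lemma smallI: "(\<And>x. E x s \<longleftrightarrow> Q x) \<Longrightarrow> small Q"
  unfolding small_def by blast

lemma mem_collect:
  assumes "small Q"
  shows "E x (collect Q) \<longleftrightarrow> Q x"
proof -
  have "\<exists>!s. \<forall>x. E x s \<longleftrightarrow> Q x" using assms unfolding small_def by (auto intro!: set_eqI)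
  from theI'[OF this] show ?thesis unfolding collect_def by blast
qed

lemma small_separation:
  assumes "fo_definable E (\<lambda>e. Q (e 0))"
  shows "small (\<lambda>x. E x a \<and> Q x)"
proof -
  obtain \<phi> where "\<And>e. sat E UNIV e \<phi> \<longleftrightarrow> Q (e 0)" using assms unfolding definable_def by blast
  then show ?thesis using separation[rule_format, of a undefined \<phi>] by (simp add: small_def)
qed

lemma small_bounded: "fo_definable E (\<lambda>e. Q (e 0)) \<Longrightarrow> (\<And>x. Q x \<Longrightarrow> E x a) \<Longrightarrow> small Q"
  using small_separation[of Q a] unfolding small_def by blast

lemma small_replacement:
  assumes R: "fo_definable_rel E R"
    and functional: "\<And>x y z. E x a \<Longrightarrow> R x y \<Longrightarrow> R x z \<Longrightarrow> y = z"
  shows "small (\<lambda>y. \<exists>x. E x a \<and> R x y)"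
proof -
  have "fo_definable E (\<lambda>e. R (e 0) (e 1))" by (intro definable_relD[OF R] definable_terms)
  then obtain \<phi> where \<phi>: "\<And>e. sat E UNIV e \<phi> \<longleftrightarrow> R (e 0) (e 1)" unfolding definable_def by blast
  have "\<exists>b. \<forall>y. E y b \<longleftrightarrow> (\<exists>x. E x a \<and> sat E UNIV (undefined(0 := x, 1 := y)) \<phi>)"
    by (rule replacement[rule_format]) (use functional in \<open>simp add: \<phi>, blast\<close>)
  then show ?thesis by (simp add: small_def \<phi>)
qed

lemma small_subsets: "small (\<lambda>x. subset E x a)"
  using power_set unfolding small_def by blast

lemma small_pair: "small (\<lambda>w. w = x \<or> w = y)"
  using pairing unfolding small_def by blast

lemma small_Union: "small (\<lambda>z. \<exists>y. E y a \<and> E z y)"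
  using union unfolding small_def by blast

lemma small_indexed_Union:
  assumes R: "fo_definable_rel E R" and small: "\<And>x. E x a \<Longrightarrow> small (R x)"
  shows "small (\<lambda>y. \<exists>x. E x a \<and> R x y)"
proof -
  have "fo_definable_rel E (\<lambda>x s. \<forall>y. E y s \<longleftrightarrow> R x y)"
    by (intro definable_relI fo_definable_intros definable_relD[OF R]; assumption)
  then have "small (\<lambda>s. \<exists>x. E x a \<and> (\<forall>y. E y s \<longleftrightarrow> R x y))"
    by (rule small_replacement) (simp add: set_eqI)
  then obtain F where F: "\<And>s. E s F \<longleftrightarrow> (\<exists>x. E x a \<and> (\<forall>y. E y s \<longleftrightarrow> R x y))"
    unfolding small_def by blast
  have "(\<exists>s. E s F \<and> E y s) \<longleftrightarrow> (\<exists>x. E x a \<and> R x y)" for y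
    unfolding F using small unfolding small_def by metis
  then show ?thesis using small_Union[of F] by simp
qed

lemma small_or:
  assumes "small P" and "small Q"
  shows "small (\<lambda>x. P x \<or> Q x)"
proof -
  obtain a b where "\<And>x. E x a \<longleftrightarrow> P x" "\<And>x. E x b \<longleftrightarrow> Q x" using assms unfolding small_def by metis
  moreover obtain c where "\<And>w. E w c \<longleftrightarrow> w = a \<or> w = b" using pairing by metis
  ultimately have "(\<exists>y. E y c \<and> E x y) \<longleftrightarrow> P x \<or> Q x" for x by auto
  then show ?thesis using small_Union[of c] by simp
qed

definition upair :: "'a \<Rightarrow> 'a \<Rightarrow> 'a" where
  "upair x y = collect (\<lambda>w. w = x \<or> w = y)"

lemma mem_upair: "E w (upair x y) \<longleftrightarrow> w = x \<or> w = y"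
  unfolding upair_def by (rule mem_collect[OF small_pair])

lemma is_upair_iff: "is_upair E x y z \<longleftrightarrow> z = upair x y"
  unfolding is_upair_def by (auto simp: mem_upair intro: set_eqI)

lemma upair_eq: "upair x y = upair x' y' \<longleftrightarrow> x = x' \<and> y = y' \<or> x = y' \<and> y = x'"
proof
  assume "upair x y = upair x' y'"
  then have "w = x \<or> w = y \<longleftrightarrow> w = x' \<or> w = y'" for w using mem_upair by metis
  then show "x = x' \<and> y = y' \<or> x = y' \<and> y = x'" by metis
qed (auto intro: set_eqI simp: mem_upair)

definition opair :: "'a \<Rightarrow> 'a \<Rightarrow> 'a" where
  "opair x y = upair (upair x x) (upair x y)"

lemma opair_eq: "opair x y = opair x' y' \<longleftrightarrow> x = x' \<and> y = y'"
  unfolding opair_def upair_eq by blast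

lemma is_opair_iff: "is_opair E x y p \<longleftrightarrow> p = opair x y"
  unfolding is_opair_def is_upair_iff opair_def by blast

lemma maps_to_iff: "maps_to E f x y \<longleftrightarrow> E (opair x y) f"
  unfolding maps_to_def is_opair_iff by blast

lemma is_function_maps_to_dom:
  assumes "is_function E f d" and "maps_to E f x y"
  shows "E x d"
proof -
  have "E (opair x y) f" using assms(2) by (simp add: maps_to_iff)
  then obtain x' y' where "E x' d" "opair x y = opair x' y'"
    using assms(1) unfolding is_function_def is_opair_iff by blast
  then show ?thesis by (simp add: opair_eq)
qed

definition succ :: "'a \<Rightarrow> 'a" where
  "succ x = collect (\<lambda>z. E z x \<or> z = x)"

lemma mem_succ: "E z (succ x) \<longleftrightarrow> E z x \<or> z = x"
proof -
  have "small (\<lambda>z. E z x)" and "small (\<lambda>z. z = x)"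
    using small_pair[of x x] by (auto intro: smallI)
  then show ?thesis unfolding succ_def by (rule mem_collect[OF small_or])
qed

lemma is_succ_iff: "is_succ E x s \<longleftrightarrow> s = succ x"
  unfolding is_succ_def by (auto simp: mem_succ intro: set_eqI)

lemma mem_asym:
  assumes "E x y"
  shows "\<not> E y x"
proof
  assume "E y x"
  obtain z where "E z (upair x y)" "\<forall>w. E w (upair x y) \<longrightarrow> \<not> E w z"
    using foundation[rule_format, of "upair x y"] by (auto simp: mem_upair)
  then show False using assms \<open>E y x\<close> by (auto simp: mem_upair)
qed

lemma mem_irrefl: "\<not> E x x"
  using mem_asym by blast

lemma succ_inject: "succ x = succ y \<longleftrightarrow> x = y"
proof
  assume "succ x = succ y"
  then have "E x (succ y)" "E y (succ x)" using mem_succ by metis+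
  then show "x = y" using mem_asym unfolding mem_succ by blast
qed simp

lemma trans_set_mem: "trans_set E t \<Longrightarrow> E x t \<Longrightarrow> E y x \<Longrightarrow> E y t"
  unfolding trans_set_def subset_def by blast

lemma trans_setI: "(\<And>x y. E x t \<Longrightarrow> E y x \<Longrightarrow> E y t) \<Longrightarrow> trans_set E t"
  unfolding trans_set_def subset_def by blast

lemma trans_set_succ: "trans_set E t \<Longrightarrow> trans_set E (succ t)"
  unfolding trans_set_def subset_def mem_succ by blast

lemma trans_set_induct:
  assumes Q: "fo_definable E (\<lambda>e. Q (e 0))" and t: "trans_set E t" and "E x t"
    and step: "\<And>x. E x t \<Longrightarrow> (\<And>y. E y x \<Longrightarrow> Q y) \<Longrightarrow> Q x"
  shows "Q x"
proof (rule ccontr)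
  assume "\<not> Q x"
  have "small (\<lambda>x. E x t \<and> \<not> Q x)" by (intro small_separation fo_definable_intros Q)
  then obtain B where B: "\<And>x. E x B \<longleftrightarrow> E x t \<and> \<not> Q x" unfolding small_def by blast
  with \<open>\<not> Q x\<close> \<open>E x t\<close> obtain y where "E y B" "\<forall>z. E z B \<longrightarrow> \<not> E z y" using foundation by blast
  then show False using step[of y] trans_set_mem[OF t] B by blast
qed

context
  fixes K :: "'a fm \<Rightarrow> bool"
  assumes K: "Delta0_closed K"
begin

lemma definable_is_upair:
  assumes "definable_term A f" "definable_term A g" "definable_term A h"
  shows "definable E K A (\<lambda>e. is_upair E (f e) (g e) (h e))"
proof -
  have "is_upair E x y z \<longleftrightarrow> E x z \<and> E y z \<and> (\<forall>w. E w z \<longrightarrow> w = x \<or> w = y)" for x y z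
    unfolding is_upair_def by blast
  then show ?thesis
    using assms by (simp, intro definable_connectives[OF K] definable_variables)
qed

lemma definable_is_opair:
  assumes "definable_term A f" "definable_term A g" "definable_term A h"
  shows "definable E K A (\<lambda>e. is_opair E (f e) (g e) (h e))"
proof -
  have "is_opair E x y p \<longleftrightarrow> (\<exists>a. E a p \<and> (\<exists>b. E b p \<and>
      is_upair E x x a \<and> is_upair E x y b \<and> is_upair E a b p))" for x y p
    unfolding is_opair_def is_upair_iff by (auto simp: mem_upair)
  then show ?thesis using assms
    by (simp, intro definable_connectives[OF K] definable_is_upair definable_variables)
qed

lemma definable_maps_to:
  "definable_term A f \<Longrightarrow> definable_term A g \<Longrightarrow> definable_term A h \<Longrightarrow>
    definable E K A (\<lambda>e. maps_to E (f e) (g e) (h e))"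
  unfolding maps_to_def
  by (intro definable_connectives[OF K] definable_is_opair definable_variables)

lemma definable_trans_set: "definable_term A f \<Longrightarrow> definable E K A (\<lambda>e. trans_set E (f e))"
  unfolding trans_set_def
  by (intro definable_connectives[OF K] definable_subset[OF K] definable_variables)

lemma definable_is_ordinal: "definable_term A f \<Longrightarrow> definable E K A (\<lambda>e. is_ordinal E (f e))"
  unfolding is_ordinal_def
  by (intro definable_connectives[OF K] definable_trans_set definable_variables)

lemmas definable_set_notions =
  definable_is_opair definable_maps_to definable_subset[OF K] definable_trans_set
  definable_is_ordinal

end

lemmas fo_definable_set_intros = fo_definable_intros definable_set_notions[OF Delta0_closed_True]

subsection \<open>Ordinals\<close>

lemma ordinal_mem: "is_ordinal E \<alpha> \<Longrightarrow> E \<beta> \<alpha> \<Longrightarrow> is_ordinal E \<beta>"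
  unfolding is_ordinal_def trans_set_def subset_def by blast

lemma ordinal_trans: "is_ordinal E \<alpha> \<Longrightarrow> E \<beta> \<alpha> \<Longrightarrow> E \<gamma> \<beta> \<Longrightarrow> E \<gamma> \<alpha>"
  unfolding is_ordinal_def using trans_set_mem by blast

lemma ordinal_succ: "is_ordinal E \<alpha> \<Longrightarrow> is_ordinal E (succ \<alpha>)"
  unfolding is_ordinal_def trans_set_def subset_def mem_succ by blast

lemma ordinalI:
  assumes "\<And>\<beta>. E \<beta> \<alpha> \<Longrightarrow> is_ordinal E \<beta>" and "\<And>\<beta> \<gamma>. E \<beta> \<alpha> \<Longrightarrow> E \<gamma> \<beta> \<Longrightarrow> E \<gamma> \<alpha>"
  shows "is_ordinal E \<alpha>"
  using assms unfolding is_ordinal_def trans_set_def subset_def by blast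

lemma ordinal_induct:
  assumes "is_ordinal E \<alpha>" and "fo_definable E (\<lambda>e. Q (e 0))"
    and step: "\<And>\<alpha>. is_ordinal E \<alpha> \<Longrightarrow> (\<And>\<beta>. E \<beta> \<alpha> \<Longrightarrow> Q \<beta>) \<Longrightarrow> Q \<alpha>"
  shows "Q \<alpha>"
proof (rule trans_set_induct[OF assms(2)])
  have succ: "is_ordinal E (succ \<alpha>)" using assms(1) by (rule ordinal_succ)
  then show "trans_set E (succ \<alpha>)" by (simp add: is_ordinal_def)
  show "E \<alpha> (succ \<alpha>)" by (simp add: mem_succ)
  show "Q \<beta>" if "E \<beta> (succ \<alpha>)" "\<And>\<gamma>. E \<gamma> \<beta> \<Longrightarrow> Q \<gamma>" for \<beta>
    using that ordinal_mem[OF succ] step by blast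
qed

lemma ordinal_least:
  assumes "is_ordinal E \<alpha>" and Q: "fo_definable E (\<lambda>e. Q (e 0))" and "Q \<alpha>"
  shows "\<exists>\<beta>. is_ordinal E \<beta> \<and> Q \<beta> \<and> (\<forall>\<gamma>. E \<gamma> \<beta> \<longrightarrow> \<not> Q \<gamma>)"
proof (rule ccontr)
  assume no_least: "\<not> ?thesis"
  have "\<not> Q \<alpha>"
  proof (rule ordinal_induct[OF assms(1)])
    show "fo_definable E (\<lambda>e. \<not> Q (e 0))" by (intro fo_definable_intros Q)
    show "\<not> Q \<beta>" if "is_ordinal E \<beta>" "\<And>\<gamma>. E \<gamma> \<beta> \<Longrightarrow> \<not> Q \<gamma>" for \<beta> using no_least that by blast
  qed
  with \<open>Q \<alpha>\<close> show False by blast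
qed

lemma ordinal_linear:
  assumes "is_ordinal E \<alpha>" and "is_ordinal E \<beta>"
  shows "E \<alpha> \<beta> \<or> \<alpha> = \<beta> \<or> E \<beta> \<alpha>"
proof -
  define comparable where "comparable x y \<longleftrightarrow> E x y \<or> x = y \<or> E y x" for x y
  have comparable: "fo_definable E (\<lambda>e. comparable (f e) (g e))"
    if "definable_term UNIV f" "definable_term UNIV g" for f g
    unfolding comparable_def by (intro fo_definable_intros that)
  have "\<forall>\<beta>. is_ordinal E \<beta> \<longrightarrow> comparable \<alpha> \<beta>"
  proof (rule ordinal_induct[OF assms(1)])
    show "fo_definable E (\<lambda>e. \<forall>\<beta>. is_ordinal E \<beta> \<longrightarrow> comparable (e 0) \<beta>)"
      by (intro fo_definable_set_intros comparable)
  next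
    fix \<alpha> assume \<alpha>: "is_ordinal E \<alpha>"
      and below_\<alpha>: "\<And>\<gamma>. E \<gamma> \<alpha> \<Longrightarrow> \<forall>\<beta>. is_ordinal E \<beta> \<longrightarrow> comparable \<gamma> \<beta>"
    have "comparable \<alpha> \<beta>" if "is_ordinal E \<beta>" for \<beta>
      using that
    proof (rule ordinal_induct)
      show "fo_definable E (\<lambda>e. comparable \<alpha> (e 0))" by (intro comparable definable_terms)
    next
      fix \<beta> assume \<beta>: "is_ordinal E \<beta>" and below_\<beta>: "\<And>\<gamma>. E \<gamma> \<beta> \<Longrightarrow> comparable \<alpha> \<gamma>"
      show "comparable \<alpha> \<beta>"
      proof (rule ccontr)
        assume incomparable: "\<not> comparable \<alpha> \<beta>"
        have "E \<gamma> \<beta>" if "E \<gamma> \<alpha>" for \<gamma>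
          using below_\<alpha>[OF that] \<beta> incomparable that ordinal_trans[OF \<alpha> that]
          unfolding comparable_def by blast
        moreover have "E \<gamma> \<alpha>" if "E \<gamma> \<beta>" for \<gamma>
          using below_\<beta>[OF that] incomparable that ordinal_trans[OF \<beta> that]
          unfolding comparable_def by blast
        ultimately have "\<alpha> = \<beta>" by (intro set_eqI) blast
        then show False using incomparable unfolding comparable_def by blast
      qed
    qed
    then show "\<forall>\<beta>. is_ordinal E \<beta> \<longrightarrow> comparable \<alpha> \<beta>" by blast
  qed
  then show ?thesis using assms(2) unfolding comparable_def by blast
qed

lemma ex_limit_ordinal: "\<exists>l. is_ordinal E l \<and> (\<exists>z. E z l) \<and> (\<forall>x. E x l \<longrightarrow> E (succ x) l)"
proof -
  obtain w z where z: "E z w" "\<forall>x. \<not> E x z"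
    and "\<forall>x. E x w \<longrightarrow> (\<exists>s. E s w \<and> is_succ E x s)"
    using infinity unfolding is_succ_def by blast
  then have w: "E (succ x) w" if "E x w" for x using that by (auto simp: is_succ_iff)
  have "small (\<lambda>n. E n w \<and> is_ordinal E n \<and> subset E n w)"
    by (intro small_separation fo_definable_set_intros)
  then obtain l where l: "\<And>n. E n l \<longleftrightarrow> E n w \<and> is_ordinal E n \<and> subset E n w"
    unfolding small_def by blast
  have "is_ordinal E l"
  proof (rule ordinalI)
    fix n m assume "E n l" "E m n"
    then have n: "is_ordinal E n" "subset E n w" by (simp_all add: l)
    then have "E m w" "is_ordinal E m" "subset E m w"
      using \<open>E m n\<close> ordinal_mem ordinal_trans[OF n(1)] unfolding subset_def by blast+
    then show "E m l" by (simp add: l)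
  qed (simp add: l)
  moreover have "E z l" using z by (simp add: l is_ordinal_def trans_set_def subset_def)
  moreover have "E (succ x) l" if "E x l" for x
    using that by (auto simp: l w ordinal_succ subset_def mem_succ)
  ultimately show ?thesis by blast
qed

subsection \<open>Recursion along ordinals\<close>

text \<open>One step \<open>H\<^sub>\<alpha> = {x. \<exists>\<gamma> < \<alpha>. S x H\<^sub>\<gamma>}\<close> of a recursion, where \<open>H \<gamma> w\<close> stands for \<open>H\<^sub>\<gamma> = w\<close>.\<close>

definition recursion_step ::
  "('a \<Rightarrow> 'a \<Rightarrow> bool) \<Rightarrow> ('a \<Rightarrow> 'a \<Rightarrow> bool) \<Rightarrow> 'a \<Rightarrow> 'a \<Rightarrow> bool" where
  "recursion_step S H \<alpha> x \<longleftrightarrow> (\<exists>\<gamma> w. E \<gamma> \<alpha> \<and> H \<gamma> w \<and> S x w)"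

lemma recursion_step_cong:
  "(\<And>\<gamma> w. E \<gamma> \<alpha> \<Longrightarrow> H \<gamma> w \<longleftrightarrow> H' \<gamma> w) \<Longrightarrow> recursion_step S H \<alpha> x \<longleftrightarrow> recursion_step S H' \<alpha> x"
  unfolding recursion_step_def by blast

definition attempt :: "('a \<Rightarrow> 'a \<Rightarrow> bool) \<Rightarrow> 'a \<Rightarrow> 'a \<Rightarrow> bool" where
  "attempt S f \<alpha> \<longleftrightarrow> is_ordinal E \<alpha> \<and> (\<forall>\<beta>. E \<beta> \<alpha> \<longrightarrow> (\<exists>u. maps_to E f \<beta> u)) \<and>
    (\<forall>\<beta> u. E \<beta> \<alpha> \<and> maps_to E f \<beta> u \<longrightarrow> (\<forall>x. E x u \<longleftrightarrow> recursion_step S (maps_to E f) \<beta> x))"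

definition level :: "('a \<Rightarrow> 'a \<Rightarrow> bool) \<Rightarrow> 'a \<Rightarrow> 'a \<Rightarrow> bool" where
  "level S \<alpha> v \<longleftrightarrow>
    (\<exists>f. attempt S f \<alpha> \<and> (\<forall>x. E x v \<longleftrightarrow> recursion_step S (maps_to E f) \<alpha> x))"

lemma attempt_ordinal: "attempt S f \<alpha> \<Longrightarrow> is_ordinal E \<alpha>"
  unfolding attempt_def by blast

lemma attempt_total: "attempt S f \<alpha> \<Longrightarrow> E \<beta> \<alpha> \<Longrightarrow> \<exists>u. maps_to E f \<beta> u"
  unfolding attempt_def by blast

lemma attempt_step:
  "attempt S f \<alpha> \<Longrightarrow> E \<beta> \<alpha> \<Longrightarrow> maps_to E f \<beta> u \<Longrightarrow>
    E x u \<longleftrightarrow> recursion_step S (maps_to E f) \<beta> x"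
  unfolding attempt_def by blast

lemma attempt_agree:
  assumes f: "attempt S f \<alpha>" and g: "attempt S g \<alpha>'" and \<beta>: "E \<beta> \<alpha>" "E \<beta> \<alpha>'"
    and "maps_to E f \<beta> u" and "maps_to E g \<beta> v"
  shows "u = v"
proof -
  define agree where "agree \<beta> \<longleftrightarrow> (E \<beta> \<alpha> \<and> E \<beta> \<alpha>' \<longrightarrow>
    (\<forall>u v. maps_to E f \<beta> u \<and> maps_to E g \<beta> v \<longrightarrow> u = v))" for \<beta>
  have trans: "E \<gamma> \<alpha>" "E \<gamma> \<alpha>'" if "E \<beta> \<alpha>" "E \<beta> \<alpha>'" "E \<gamma> \<beta>" for \<beta> \<gamma>
    using that f g attempt_ordinal ordinal_trans by blast+
  have "agree \<beta>"
  proof (rule ordinal_induct)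
    show "is_ordinal E \<beta>" using f \<beta>(1) attempt_ordinal ordinal_mem by blast
    show "fo_definable E (\<lambda>e. agree (e 0))"
      unfolding agree_def by (intro fo_definable_set_intros)
  next
    fix \<beta> assume IH: "\<And>\<gamma>. E \<gamma> \<beta> \<Longrightarrow> agree \<gamma>"
    show "agree \<beta>"
      unfolding agree_def
    proof (intro impI allI)
      fix u v assume \<beta>: "E \<beta> \<alpha> \<and> E \<beta> \<alpha>'" and uv: "maps_to E f \<beta> u \<and> maps_to E g \<beta> v"
      have same: "maps_to E f \<gamma> w \<longleftrightarrow> maps_to E g \<gamma> w" if "E \<gamma> \<beta>" for \<gamma> w
        using IH[OF that] trans[of \<beta> \<gamma>] \<beta> that attempt_total[OF f] attempt_total[OF g]
        unfolding agree_def by metis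
      show "u = v"
        using attempt_step[OF f, of \<beta> u] attempt_step[OF g, of \<beta> v] \<beta> uv
        by (intro set_eqI) (simp add: recursion_step_cong[OF same])
    qed
  qed
  with assms show ?thesis unfolding agree_def by blast
qed

lemma attempt_maps_to_cong:
  "attempt S f \<alpha> \<Longrightarrow> attempt S g \<alpha>' \<Longrightarrow> E \<beta> \<alpha> \<Longrightarrow> E \<beta> \<alpha>' \<Longrightarrow> maps_to E f \<beta> u \<longleftrightarrow> maps_to E g \<beta> u"
  using attempt_agree[of S f \<alpha> g \<alpha>' \<beta>] attempt_total[of S f \<alpha> \<beta>] attempt_total[of S g \<alpha>' \<beta>] by metis

lemma level_unique:
  assumes "level S \<alpha> v" and "level S \<alpha> v'"
  shows "v = v'"
proof -
  obtain f where f: "attempt S f \<alpha>" "\<And>x. E x v \<longleftrightarrow> recursion_step S (maps_to E f) \<alpha> x"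
    using assms(1) unfolding level_def by blast
  obtain g where g: "attempt S g \<alpha>" "\<And>x. E x v' \<longleftrightarrow> recursion_step S (maps_to E g) \<alpha> x"
    using assms(2) unfolding level_def by blast
  show ?thesis
    by (rule set_eqI)
      (simp add: f(2) g(2) recursion_step_cong[OF attempt_maps_to_cong[OF f(1) g(1)]])
qed

lemma attempt_maps_to_iff_level:
  assumes f: "attempt S f \<alpha>" and \<beta>: "E \<beta> \<alpha>"
  shows "maps_to E f \<beta> u \<longleftrightarrow> level S \<beta> u"
proof -
  have "is_ordinal E \<alpha>" using f by (rule attempt_ordinal)
  then have "is_ordinal E \<beta>" and "\<And>\<gamma>. E \<gamma> \<beta> \<Longrightarrow> E \<gamma> \<alpha>"
    using \<beta> ordinal_mem ordinal_trans by blast+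
  then have "attempt S f \<beta>" using f unfolding attempt_def by blast
  then have "level S \<beta> v" if "maps_to E f \<beta> v" for v
    unfolding level_def using attempt_step[OF f \<beta> that] by blast
  then show ?thesis using attempt_total[OF f \<beta>] level_unique by blast
qed

lemma level_iff:
  assumes "level S \<alpha> v"
  shows "E x v \<longleftrightarrow> recursion_step S (level S) \<alpha> x"
proof -
  obtain f where f: "attempt S f \<alpha>" "E x v \<longleftrightarrow> recursion_step S (maps_to E f) \<alpha> x"
    using assms unfolding level_def by blast
  then show ?thesis using recursion_step_cong[OF attempt_maps_to_iff_level[OF f(1)]] by simp
qed

lemma level_ordinal: "level S \<alpha> v \<Longrightarrow> is_ordinal E \<alpha>"
  unfolding level_def using attempt_ordinal by blast

lemma fo_definable_level:
  assumes "fo_definable_rel E S" and "definable_term UNIV f" and "definable_term UNIV g"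
  shows "fo_definable E (\<lambda>e. level S (f e) (g e))"
  unfolding level_def attempt_def recursion_step_def
  by (intro fo_definable_set_intros definable_relD[OF assms(1)] assms(2,3))

definition level_graph :: "('a \<Rightarrow> 'a \<Rightarrow> bool) \<Rightarrow> 'a \<Rightarrow> 'a" where
  "level_graph S \<alpha> = collect (\<lambda>p. \<exists>\<gamma>. E \<gamma> \<alpha> \<and> (\<exists>w. level S \<gamma> w \<and> is_opair E \<gamma> w p))"

context
  fixes S :: "'a \<Rightarrow> 'a \<Rightarrow> bool"
  assumes definable_S: "fo_definable_rel E S" and small_S: "\<And>w. small (\<lambda>x. S x w)"
begin

lemma mem_level_graph: "E p (level_graph S \<alpha>) \<longleftrightarrow> (\<exists>\<gamma> w. E \<gamma> \<alpha> \<and> level S \<gamma> w \<and> is_opair E \<gamma> w p)"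
proof -
  have "small (\<lambda>p. \<exists>\<gamma>. E \<gamma> \<alpha> \<and> (\<exists>w. level S \<gamma> w \<and> is_opair E \<gamma> w p))"
  proof (rule small_replacement)
    show "fo_definable_rel E (\<lambda>\<gamma> p. \<exists>w. level S \<gamma> w \<and> is_opair E \<gamma> w p)"
      by (intro definable_relI fo_definable_set_intros fo_definable_level[OF definable_S])
  qed (metis level_unique is_opair_iff)
  then show ?thesis unfolding level_graph_def by (subst mem_collect) blast+
qed

lemma maps_to_level_graph: "maps_to E (level_graph S \<alpha>) \<gamma> w \<longleftrightarrow> E \<gamma> \<alpha> \<and> level S \<gamma> w"
  unfolding maps_to_iff mem_level_graph is_opair_iff opair_eq by blast

lemma attempt_level_graph:
  assumes "is_ordinal E \<alpha>" and "\<And>\<gamma>. E \<gamma> \<alpha> \<Longrightarrow> \<exists>v. level S \<gamma> v"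
  shows "attempt S (level_graph S \<alpha>) \<alpha>"
  unfolding attempt_def maps_to_level_graph recursion_step_def
  using assms level_iff[unfolded recursion_step_def] ordinal_trans[OF assms(1)] by blast

lemma level_exists:
  assumes "is_ordinal E \<alpha>"
  shows "\<exists>v. level S \<alpha> v"
  using assms
proof (rule ordinal_induct)
  show "fo_definable E (\<lambda>e. \<exists>v. level S (e 0) v)"
    by (intro fo_definable_set_intros fo_definable_level[OF definable_S])
next
  fix \<alpha> assume "is_ordinal E \<alpha>" and below: "\<And>\<beta>. E \<beta> \<alpha> \<Longrightarrow> \<exists>v. level S \<beta> v"
  then have attempt: "attempt S (level_graph S \<alpha>) \<alpha>" by (rule attempt_level_graph)
  have "small (\<lambda>x. \<exists>\<gamma>. E \<gamma> \<alpha> \<and> (\<exists>w. level S \<gamma> w \<and> S x w))"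
  proof (rule small_indexed_Union)
    show "fo_definable_rel E (\<lambda>\<gamma> x. \<exists>w. level S \<gamma> w \<and> S x w)"
      by (intro definable_relI fo_definable_set_intros fo_definable_level[OF definable_S]
          definable_relD[OF definable_S])
    show "small (\<lambda>x. \<exists>w. level S \<gamma> w \<and> S x w)" if \<gamma>: "E \<gamma> \<alpha>" for \<gamma>
    proof -
      obtain v where "level S \<gamma> v" using below[OF \<gamma>] by blast
      then have "S x v \<longleftrightarrow> (\<exists>w. level S \<gamma> w \<and> S x w)" for x using level_unique by blast
      then show ?thesis using small_S[of v] by simp
    qed
  qed
  then obtain v where "\<And>x. E x v \<longleftrightarrow> recursion_step S (level S) \<alpha> x"
    unfolding small_def recursion_step_def by auto
  then have "E x v \<longleftrightarrow> recursion_step S (maps_to E (level_graph S \<alpha>)) \<alpha> x" for x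
    by (simp add: recursion_step_def maps_to_level_graph)
  with attempt show "\<exists>v. level S \<alpha> v" unfolding level_def[of S \<alpha>] by blast
qed

lemma level_limit_mem:
  assumes T: "level S l T" and limit: "\<And>\<gamma>. E \<gamma> l \<Longrightarrow> E (succ \<gamma>) l" and "E y T"
  shows "\<exists>\<gamma> w. E \<gamma> l \<and> level S \<gamma> w \<and> E y w"
proof -
  obtain \<gamma> w where \<gamma>: "E \<gamma> l" "level S \<gamma> w" "S y w"
    using \<open>E y T\<close> unfolding level_iff[OF T] recursion_step_def by blast
  then have "is_ordinal E (succ \<gamma>)" using level_ordinal ordinal_succ by blast
  then obtain w' where w': "level S (succ \<gamma>) w'" using level_exists by blast
  then have "E y w'" unfolding level_iff[OF w'] recursion_step_def using \<gamma> mem_succ by blast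
  then show ?thesis using limit[OF \<gamma>(1)] w' by blast
qed

lemma level_iff_function:
  "level S \<alpha> v \<longleftrightarrow> is_ordinal E \<alpha> \<and> (\<exists>f. is_function E f (succ \<alpha>) \<and>
     (\<forall>\<beta> u. maps_to E f \<beta> u \<longrightarrow> (\<forall>x. E x u \<longleftrightarrow> recursion_step S (maps_to E f) \<beta> x)) \<and>
     maps_to E f \<alpha> v)"
proof safe
  assume v: "level S \<alpha> v"
  then show \<alpha>: "is_ordinal E \<alpha>" by (rule level_ordinal)
  let ?f = "level_graph S (succ \<alpha>)"
  have succ: "is_ordinal E (succ \<alpha>)" using \<alpha> by (rule ordinal_succ)
  have "is_function E ?f (succ \<alpha>)"
    unfolding is_function_def maps_to_level_graph mem_level_graph
    using level_exists level_unique ordinal_mem[OF succ] by blast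
  moreover have "E x u \<longleftrightarrow> recursion_step S (maps_to E ?f) \<beta> x" if "maps_to E ?f \<beta> u" for \<beta> u x
    using that level_iff[unfolded recursion_step_def] ordinal_trans[OF succ]
    unfolding maps_to_level_graph recursion_step_def by blast
  moreover have "maps_to E ?f \<alpha> v" using v by (simp add: maps_to_level_graph mem_succ)
  ultimately show "\<exists>f. is_function E f (succ \<alpha>) \<and>
      (\<forall>\<beta> u. maps_to E f \<beta> u \<longrightarrow> (\<forall>x. E x u \<longleftrightarrow> recursion_step S (maps_to E f) \<beta> x)) \<and>
      maps_to E f \<alpha> v" by blast
next
  fix f assume \<alpha>: "is_ordinal E \<alpha>" and f: "is_function E f (succ \<alpha>)" "maps_to E f \<alpha> v"
    and "\<forall>\<beta> u. maps_to E f \<beta> u \<longrightarrow> (\<forall>x. E x u \<longleftrightarrow> recursion_step S (maps_to E f) \<beta> x)"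
  then have "attempt S f (succ \<alpha>)"
    unfolding attempt_def is_function_def using ordinal_succ[OF \<alpha>] by blast
  then show "level S \<alpha> v" using attempt_maps_to_iff_level f(2) mem_succ by blast
qed

end

subsection \<open>The cumulative hierarchy\<close>

lemmas fo_definable_rel_subset = definable_rel_subset[OF Delta0_closed_True]

lemma is_V_iff_level: "is_V E \<alpha> v \<longleftrightarrow> level (subset E) \<alpha> v"
  unfolding is_V_def is_succ_iff
    level_iff_function[where S = "subset E", OF fo_definable_rel_subset small_subsets]
    recursion_step_def by simp

lemma V_exists: "is_ordinal E \<alpha> \<Longrightarrow> \<exists>v. is_V E \<alpha> v"
  unfolding is_V_iff_level by (rule level_exists[OF fo_definable_rel_subset small_subsets])

lemma V_unique: "is_V E \<alpha> v \<Longrightarrow> is_V E \<alpha> v' \<Longrightarrow> v = v'"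
  unfolding is_V_iff_level by (rule level_unique)

lemma V_iff: "is_V E \<alpha> v \<Longrightarrow> E x v \<longleftrightarrow> (\<exists>\<gamma> w. E \<gamma> \<alpha> \<and> is_V E \<gamma> w \<and> subset E x w)"
  unfolding is_V_iff_level by (rule level_iff[unfolded recursion_step_def])

lemma V_ordinal: "is_V E \<alpha> v \<Longrightarrow> is_ordinal E \<alpha>"
  unfolding is_V_def by blast

lemma fo_definable_V:
  "definable_term UNIV f \<Longrightarrow> definable_term UNIV g \<Longrightarrow> fo_definable E (\<lambda>e. is_V E (f e) (g e))"
  unfolding is_V_iff_level by (rule fo_definable_level[OF fo_definable_rel_subset])

definition unbounded :: "'a \<Rightarrow> bool" where
  "unbounded x \<longleftrightarrow> (\<forall>y. E y x \<longrightarrow> (\<exists>z. E z x \<and> E y z))"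

text \<open>
  In the recursion \<open>H\<^sub>\<alpha> = {y. \<exists>\<gamma> < \<alpha>. y \<in> c \<or> y \<subseteq> H\<^sub>\<gamma> \<or> y \<in> \<Union>H\<^sub>\<gamma>}\<close> up to a limit, the last disjunct
  gives transitivity and the second one puts \<open>{y}\<close> above each \<open>y\<close>.
\<close>

lemma ex_transitive_unbounded: "\<exists>T. trans_set E T \<and> subset E c T \<and> unbounded T"
proof -
  define S where "S y w \<longleftrightarrow> E y c \<or> subset E y w \<or> (\<exists>z. E z w \<and> E y z)" for y w
  have definable_S: "fo_definable_rel E S"
    unfolding S_def by (intro definable_relI fo_definable_set_intros)
  have "small (\<lambda>y. E y c)" by (auto intro: smallI)
  then have small_S: "small (\<lambda>y. S y w)" for w
    unfolding S_def by (intro small_or small_subsets small_Union)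
  have level_exists: "\<exists>v. level S \<alpha> v" if "is_ordinal E \<alpha>" for \<alpha>
    using level_exists[OF definable_S small_S that] .
  obtain l where l: "is_ordinal E l" "\<exists>z. E z l" "\<And>x. E x l \<Longrightarrow> E (succ x) l"
    using ex_limit_ordinal by blast
  obtain T where T: "level S l T" using level_exists[OF l(1)] by blast
  have in_T: "E y T" if "E \<gamma> l" "level S \<gamma> w" "S y w" for y \<gamma> w
    using that unfolding level_iff[OF T] recursion_step_def by blast
  note stage = level_limit_mem[OF definable_S small_S T l(3)]
  have "trans_set E T"
  proof (rule trans_setI)
    fix y z assume "E y T" "E z y"
    then obtain \<gamma> w where "E \<gamma> l" "level S \<gamma> w" "S z w" using stage unfolding S_def by blast
    then show "E z T" by (rule in_T)
  qed
  moreover obtain \<gamma> w where "E \<gamma> l" "level S \<gamma> w"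
    using l(2) level_exists ordinal_mem[OF l(1)] by blast
  then have "subset E c T" using in_T unfolding subset_def S_def by blast
  moreover have "unbounded T"
    unfolding unbounded_def
  proof (intro allI impI)
    fix y assume "E y T"
    then obtain \<gamma> w where \<gamma>: "E \<gamma> l" "level S \<gamma> w" and "E y w" using stage by blast
    then have "S (upair y y) w" by (simp add: S_def subset_def mem_upair)
    then have "E (upair y y) T" by (rule in_T[OF \<gamma>])
    then show "\<exists>z. E z T \<and> E y z" using mem_upair by blast
  qed
  ultimately show ?thesis by blast
qed

lemma ex_transitive_mem: "\<exists>T. trans_set E T \<and> E x T"
  using ex_transitive_unbounded[of "upair x x"] unfolding subset_def mem_upair by blast

lemma mem_induct:
  assumes "fo_definable E (\<lambda>e. Q (e 0))" and "\<And>x. (\<And>y. E y x \<Longrightarrow> Q y) \<Longrightarrow> Q x"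
  shows "Q x"
proof -
  obtain T where "trans_set E T" "E x T" using ex_transitive_mem by blast
  then show ?thesis using assms(2) by (rule trans_set_induct[OF assms(1)])
qed

definition V_includes :: "'a \<Rightarrow> 'a \<Rightarrow> bool" where
  "V_includes \<alpha> x \<longleftrightarrow> (\<exists>v. is_V E \<alpha> v \<and> subset E x v)"

lemma fo_definable_V_includes:
  "definable_term UNIV f \<Longrightarrow> definable_term UNIV g \<Longrightarrow> fo_definable E (\<lambda>e. V_includes (f e) (g e))"
  unfolding V_includes_def by (intro fo_definable_set_intros fo_definable_V)

lemma V_includes_ordinal: "V_includes \<alpha> x \<Longrightarrow> is_ordinal E \<alpha>"
  unfolding V_includes_def using V_ordinal by blast

text \<open>The condition on \<open>\<gamma>\<close> says that \<open>\<gamma>\<close> is at most the rank of \<open>z\<close>.\<close>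

lemma small_ordinals_le_rank:
  assumes "V_includes \<alpha> z"
  shows "small (\<lambda>\<gamma>. is_ordinal E \<gamma> \<and> (\<forall>\<beta>. E \<beta> \<gamma> \<longrightarrow> \<not> V_includes \<beta> z))"
proof (rule small_bounded)
  show "fo_definable E (\<lambda>e. is_ordinal E (e 0) \<and> (\<forall>\<beta>. E \<beta> (e 0) \<longrightarrow> \<not> V_includes \<beta> z))"
    by (intro fo_definable_set_intros fo_definable_V_includes)
  show "E \<gamma> (succ \<alpha>)" if "is_ordinal E \<gamma> \<and> (\<forall>\<beta>. E \<beta> \<gamma> \<longrightarrow> \<not> V_includes \<beta> z)" for \<gamma>
    using that ordinal_linear[of \<gamma> \<alpha>] V_includes_ordinal[OF assms] assms unfolding mem_succ by blast
qed

lemma V_covers: "\<exists>\<alpha>. V_includes \<alpha> x"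
proof (rule mem_induct)
  show "fo_definable E (\<lambda>e. \<exists>\<alpha>. V_includes \<alpha> (e 0))"
    by (intro fo_definable_set_intros fo_definable_V_includes)
next
  fix x assume IH: "\<And>z. E z x \<Longrightarrow> \<exists>\<alpha>. V_includes \<alpha> z"
  define le_rank where "le_rank z \<gamma> \<longleftrightarrow> is_ordinal E \<gamma> \<and> (\<forall>\<beta>. E \<beta> \<gamma> \<longrightarrow> \<not> V_includes \<beta> z)" for z \<gamma>
  have "small (\<lambda>\<gamma>. \<exists>z. E z x \<and> le_rank z \<gamma>)"
  proof (rule small_indexed_Union)
    show "fo_definable_rel E le_rank"
      unfolding le_rank_def
      by (intro definable_relI fo_definable_set_intros fo_definable_V_includes)
    show "small (le_rank z)" if "E z x" for z
      using IH[OF that] small_ordinals_le_rank unfolding le_rank_def by blast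
  qed
  then obtain \<alpha> where \<alpha>: "\<And>\<gamma>. E \<gamma> \<alpha> \<longleftrightarrow> (\<exists>z. E z x \<and> le_rank z \<gamma>)" unfolding small_def by blast
  have "is_ordinal E \<alpha>"
  proof (rule ordinalI)
    show "is_ordinal E \<gamma>" if "E \<gamma> \<alpha>" for \<gamma> using that unfolding \<alpha> le_rank_def by blast
    show "E \<delta> \<alpha>" if "E \<gamma> \<alpha>" "E \<delta> \<gamma>" for \<gamma> \<delta>
      using that ordinal_mem ordinal_trans unfolding \<alpha> le_rank_def by blast
  qed
  then obtain v where v: "is_V E \<alpha> v" using V_exists by blast
  have "E z v" if z: "E z x" for z
  proof -
    obtain \<beta> where "V_includes \<beta> z" using IH[OF z] by blast
    moreover have "fo_definable E (\<lambda>e. V_includes (e 0) z)"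
      by (intro fo_definable_V_includes definable_terms)
    ultimately obtain \<rho> where "V_includes \<rho> z" "le_rank z \<rho>"
      using ordinal_least[of \<beta> "\<lambda>\<beta>. V_includes \<beta> z"] V_includes_ordinal
      unfolding le_rank_def by blast
    then have "E \<rho> \<alpha>" using \<alpha> z by blast
    then show ?thesis using V_iff[OF v] \<open>V_includes \<rho> z\<close> unfolding V_includes_def by blast
  qed
  then show "\<exists>\<alpha>. V_includes \<alpha> x" using v unfolding V_includes_def subset_def by blast
qed

definition range_bound :: "'a \<Rightarrow> 'a \<Rightarrow> bool" where
  "range_bound f t \<longleftrightarrow> (\<forall>p. E p f \<longrightarrow> (\<forall>a. E a p \<longrightarrow> (\<forall>u. E u a \<longrightarrow> E u t)))"

lemma maps_to_range_bound: "range_bound f t \<Longrightarrow> maps_to E f x u \<Longrightarrow> E u t"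
  unfolding range_bound_def maps_to_iff opair_def using mem_upair by blast

lemma ex_range_bound: "\<exists>t. range_bound f t"
proof -
  obtain a where "\<And>z. E z a \<longleftrightarrow> (\<exists>y. E y f \<and> E z y)" using union by metis
  moreover obtain t where "\<And>z. E z t \<longleftrightarrow> (\<exists>y. E y a \<and> E z y)" using union by metis
  ultimately show ?thesis unfolding range_bound_def by blast
qed

text \<open>
  Bounding the range of \<open>f\<close> by \<open>t\<close> leaves \<open>x\<close> as the only unbounded variable, so that \<open>level\<close> is
  \<open>\<Sigma>\<^sub>2\<close>.
\<close>

definition level_matrix :: "('a \<Rightarrow> 'a \<Rightarrow> bool) \<Rightarrow> 'a \<Rightarrow> 'a \<Rightarrow> 'a \<Rightarrow> 'a \<Rightarrow> 'a \<Rightarrow> bool" where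
  "level_matrix S f t \<alpha> v x \<longleftrightarrow> range_bound f t \<and> is_ordinal E \<alpha> \<and>
    (\<forall>\<beta>. E \<beta> \<alpha> \<longrightarrow> (\<exists>u. E u t \<and> maps_to E f \<beta> u)) \<and>
    (\<forall>\<beta>. E \<beta> \<alpha> \<longrightarrow> (\<forall>u. E u t \<longrightarrow> maps_to E f \<beta> u \<longrightarrow>
      (E x u \<longleftrightarrow> (\<exists>\<gamma>. E \<gamma> \<beta> \<and> (\<exists>w. E w t \<and> maps_to E f \<gamma> w \<and> S x w))))) \<and>
    (E x v \<longleftrightarrow> (\<exists>\<gamma>. E \<gamma> \<alpha> \<and> (\<exists>w. E w t \<and> maps_to E f \<gamma> w \<and> S x w)))"

lemma level_iff_matrix: "level S \<alpha> v \<longleftrightarrow> (\<exists>f t. \<forall>x. level_matrix S f t \<alpha> v x)"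
proof -
  have "(\<forall>x. level_matrix S f t \<alpha> v x) \<longleftrightarrow> attempt S f \<alpha> \<and>
      (\<forall>x. E x v \<longleftrightarrow> recursion_step S (maps_to E f) \<alpha> x)" if "range_bound f t" for f t
  proof -
    have drop_bound: "E u t \<and> maps_to E f \<beta> u \<longleftrightarrow> maps_to E f \<beta> u"
      "E u t \<and> maps_to E f \<beta> u \<and> Q \<longleftrightarrow> maps_to E f \<beta> u \<and> Q"
      "(E u t \<longrightarrow> maps_to E f \<beta> u \<longrightarrow> Q) \<longleftrightarrow> (maps_to E f \<beta> u \<longrightarrow> Q)" for \<beta> u Q
      using maps_to_range_bound[OF that] by blast+
    show ?thesis
      unfolding level_matrix_def attempt_def recursion_step_def drop_bound using that by simp blast
  qed
  moreover have "range_bound f t" if "\<forall>x. level_matrix S f t \<alpha> v x" for f t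
    using that unfolding level_matrix_def by blast
  ultimately show ?thesis unfolding level_def using ex_range_bound by metis
qed

lemma definable_level_matrix:
  assumes "Delta0_closed K" and "definable_rel E K A S"
    and "definable_term A f" "definable_term A t" "definable_term A a" "definable_term A v"
    and "definable_term A x"
  shows "definable E K A (\<lambda>e. level_matrix S (f e) (t e) (a e) (v e) (x e))"
  unfolding level_matrix_def range_bound_def
  by (intro definable_connectives[OF assms(1)] definable_set_notions[OF assms(1)]
      definable_relD[OF assms(2)] definable_variables assms(3-))

end

section \<open>Truth in large worlds\<close>

definition extensions :: "('a \<Rightarrow> 'a \<Rightarrow> bool) \<Rightarrow> 'a \<Rightarrow> 'a set" where
  "extensions E W = {U. trans_set E U \<and> subset E W U}"

definition large_worlds :: "('a \<Rightarrow> 'a \<Rightarrow> bool) \<Rightarrow> 'a filter" where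
  "large_worlds E = (INF W\<in>{W. trans_set E W}. principal (extensions E W))"

lemma extensions_refl: "trans_set E W \<Longrightarrow> W \<in> extensions E W"
  by (simp add: extensions_def subset_def)

lemma extensions_trans: "U \<in> extensions E W \<Longrightarrow> U' \<in> extensions E U \<Longrightarrow> U' \<in> extensions E W"
  by (simp add: extensions_def subset_def)

lemma true_at_Box: "true_at E W (Box p) \<longleftrightarrow> (\<forall>U\<in>extensions E W. true_at E U p)"
  by (simp add: extensions_def)

lemma true_at_Dia: "true_at E W (Dia p) \<longleftrightarrow> (\<exists>U\<in>extensions E W. true_at E U p)"
  by (auto simp: extensions_def)

lemma Delta0_absolute:
  assumes "Delta0_fm \<phi>" and U: "trans_set E U" and "denotations e \<phi> \<subseteq> ext E U"
  shows "sat E (ext E U) e \<phi> \<longleftrightarrow> sat E UNIV e \<phi>"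
  using assms(1,3)
proof (induction \<phi> arbitrary: e rule: Delta0_fm_induct)
  case (BEx \<phi> t n)
  have "E (val e t) U" using BEx.hyps(2) BEx.prems by (cases t) (auto simp: denotations_def ext_def)
  then have mem: "E x U" if "E x (val e t)" for x
    using that U unfolding trans_set_def subset_def by blast
  have "sat E (ext E U) (e(n := x)) \<phi> \<longleftrightarrow> sat E UNIV (e(n := x)) \<phi>" if "E x U" for x
    using BEx.prems that by (intro BEx.IH) (auto simp: denotations_def ext_def)
  then show ?case using mem by (auto simp: val_upd_other[OF BEx.hyps(2)] ext_def)
next
  case (BAll \<phi> t n)
  have "E (val e t) U"
    using BAll.hyps(2) BAll.prems by (cases t) (auto simp: denotations_def ext_def FImp_def)
  then have mem: "E x U" if "E x (val e t)" for x
    using that U unfolding trans_set_def subset_def by blast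
  have "sat E (ext E U) (e(n := x)) \<phi> \<longleftrightarrow> sat E UNIV (e(n := x)) \<phi>" if "E x U" for x
    using BAll.prems that by (intro BAll.IH) (auto simp: denotations_def ext_def FImp_def)
  then show ?case using mem by (auto simp: val_upd_other[OF BAll.hyps(2)] ext_def FImp_def)
qed (simp_all add: denotations_simps)

lemma Pi_fm_Suc_induct [consumes 1, case_names Sigma All]:
  assumes "Pi_fm (Suc n) \<phi>" and "\<And>\<phi>. Sigma_fm n \<phi> \<Longrightarrow> P \<phi>" and "\<And>k \<phi>. P \<phi> \<Longrightarrow> P (FAll k \<phi>)"
  shows "P \<phi>"
  using assms(1)
proof (induction \<phi> rule: fm.induct)
  case (FAll k \<phi>)
  from FAll.prems show ?case by cases (use FAll.IH assms in auto)
qed (erule Pi_fm.cases; simp add: assms(2))+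

lemma Sigma_fm_Suc_induct [consumes 1, case_names Pi Ex]:
  assumes "Sigma_fm (Suc n) \<phi>" and "\<And>\<phi>. Pi_fm n \<phi> \<Longrightarrow> P \<phi>" and "\<And>k \<phi>. P \<phi> \<Longrightarrow> P (FEx k \<phi>)"
  shows "P \<phi>"
  using assms(1)
proof (induction \<phi> rule: fm.induct)
  case (FEx k \<phi>)
  from FEx.prems show ?case by cases (use FEx.IH assms in auto)
qed (erule Sigma_fm.cases; simp add: assms(2))+

lemma Delta0_if_Sigma_0: "Sigma_fm 0 \<phi> \<Longrightarrow> Delta0_fm \<phi>"
  by (erule Sigma_fm.cases) auto

lemma Pi1_downward:
  assumes "Pi_fm (Suc 0) \<phi>" and U: "trans_set E U" and "denotations e \<phi> \<subseteq> ext E U"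
    and "sat E UNIV e \<phi>"
  shows "sat E (ext E U) e \<phi>"
  using assms(1,3,4)
proof (induction arbitrary: e rule: Pi_fm_Suc_induct)
  case (Sigma \<phi>)
  then show ?case using Delta0_absolute[OF Delta0_if_Sigma_0 U] by simp
next
  case (All k \<phi>)
  have denotations: "denotations (e(k := x)) \<phi> \<subseteq> ext E U" if "x \<in> ext E U" for x
    using All.prems(1) that denotations_upd(2)[of e k x \<phi>] by blast
  have "sat E (ext E U) (e(k := x)) \<phi>" if "x \<in> ext E U" for x
    by (rule All.IH[OF denotations[OF that]]) (use All.prems(2) in \<open>simp del: fun_upd_apply\<close>)
  then show ?case by simp
qed

context ZFC
begin

lemma ex_common_extension: "\<exists>W. W \<in> extensions E U \<and> W \<in> extensions E U'"
proof -
  have "small (\<lambda>x. E x U \<or> E x U')" by (intro small_or) (auto intro: smallI)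
  then obtain c where "\<And>x. E x c \<longleftrightarrow> E x U \<or> E x U'" unfolding small_def by blast
  moreover obtain T where "trans_set E T" "subset E c T" using ex_transitive_unbounded by blast
  ultimately show ?thesis unfolding extensions_def subset_def by blast
qed

lemma eventually_large_worlds:
  "eventually P (large_worlds E) \<longleftrightarrow> (\<exists>W. trans_set E W \<and> (\<forall>U\<in>extensions E W. P U))"
proof -
  have nonempty: "{W. trans_set E W} \<noteq> {}" using ex_transitive_mem by blast
  have directed: "\<exists>W\<in>{W. trans_set E W}. principal (extensions E W) \<le>
      inf (principal (extensions E U)) (principal (extensions E U'))" for U U'
  proof -
    obtain W where "W \<in> extensions E U" "W \<in> extensions E U'" using ex_common_extension by blast
    then have "extensions E W \<subseteq> extensions E U \<inter> extensions E U'" "trans_set E W"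
      by (auto simp: extensions_def subset_def)
    then show ?thesis by auto
  qed
  show ?thesis
    unfolding large_worlds_def eventually_INF_base[OF nonempty directed]
    by (simp add: eventually_principal)
qed

lemma eventually_extensions: "trans_set E M \<Longrightarrow> \<forall>\<^sub>F U in large_worlds E. U \<in> extensions E M"
  unfolding eventually_large_worlds by blast

lemma eventually_large_worlds_above:
  assumes "trans_set E M"
  shows "eventually P (large_worlds E) \<longleftrightarrow> (\<exists>W\<in>extensions E M. \<forall>U\<in>extensions E W. P U)"
proof
  assume "eventually P (large_worlds E)"
  then have "\<forall>\<^sub>F U in large_worlds E. P U \<and> U \<in> extensions E M"
    using eventually_extensions[OF assms] by (rule eventually_conj)
  then show "\<exists>W\<in>extensions E M. \<forall>U\<in>extensions E W. P U"
    unfolding eventually_large_worlds using extensions_refl by fast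
qed (auto simp: eventually_large_worlds extensions_def)

lemma eventually_trans_set: "\<forall>\<^sub>F U in large_worlds E. trans_set E U"
  unfolding eventually_large_worlds extensions_def using ex_transitive_mem by blast

lemma eventually_mem: "\<forall>\<^sub>F U in large_worlds E. E x U"
  unfolding eventually_large_worlds extensions_def subset_def using ex_transitive_mem by blast

lemma eventually_denotations: "\<forall>\<^sub>F U in large_worlds E. denotations e \<phi> \<subseteq> ext E U"
proof -
  have "\<forall>\<^sub>F U in large_worlds E. \<forall>x\<in>denotations e \<phi>. E x U"
    by (intro eventually_ball_finite finite_denotations ballI eventually_mem)
  then show ?thesis by (rule eventually_mono) (auto simp: ext_def)
qed

lemma Pi1_eventually_false:
  "Pi_fm (Suc 0) \<phi> \<Longrightarrow> \<not> sat E UNIV e \<phi> \<Longrightarrow> \<forall>\<^sub>F U in large_worlds E. \<not> sat E (ext E U) e \<phi>"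
proof (induction arbitrary: e rule: Pi_fm_Suc_induct)
  case (Sigma \<phi>)
  show ?case
    using eventually_trans_set eventually_denotations[of e \<phi>]
    by eventually_elim (simp add: Sigma Delta0_absolute[OF Delta0_if_Sigma_0])
next
  case (All k \<phi>)
  then obtain x where "\<not> sat E UNIV (e(k := x)) \<phi>" by auto
  then have "\<forall>\<^sub>F U in large_worlds E. \<not> sat E (ext E U) (e(k := x)) \<phi>" by (rule All.IH)
  with eventually_mem[of x] show ?case
    by eventually_elim (auto simp: ext_def)
qed

lemma Sigma2_eventually:
  "Sigma_fm 2 \<phi> \<Longrightarrow> sat E UNIV e \<phi> \<Longrightarrow> \<forall>\<^sub>F U in large_worlds E. sat E (ext E U) e \<phi>"
  unfolding numeral_2_eq_2
proof (induction arbitrary: e rule: Sigma_fm_Suc_induct)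
  case (Pi \<phi>)
  show ?case
    using eventually_trans_set eventually_denotations[of e \<phi>]
    by eventually_elim (rule Pi1_downward[OF Pi.hyps _ _ Pi.prems])
next
  case (Ex k \<phi>)
  then obtain x where "sat E UNIV (e(k := x)) \<phi>" by auto
  then have "\<forall>\<^sub>F U in large_worlds E. sat E (ext E U) (e(k := x)) \<phi>" by (rule Ex.IH)
  with eventually_mem[of x] show ?case
    by eventually_elim (auto simp: ext_def)
qed

section \<open>Validity of S5 implies \<open>\<Sigma>\<^sub>2\<close>-elementarity\<close>

lemma true_at_Dia_Box:
  "trans_set E M \<Longrightarrow> true_at E M (Dia (Box p)) \<longleftrightarrow> (\<forall>\<^sub>F U in large_worlds E. true_at E U p)"
  by (simp only: true_at_Dia true_at_Box eventually_large_worlds_above)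

lemma S5_reflects_models:
  assumes "trans_set E M" and "S5 \<subseteq> Val E M (lang E M)" and "\<phi> \<in> lang E M"
    and "\<forall>\<^sub>F U in large_worlds E. models E (ext E U) \<phi>"
  shows "models E (ext E M) \<phi>"
proof -
  have "MImp (Dia (Box (Atom 0))) (Atom 0) \<in> Val E M (lang E M)" using assms(2) S5.Five by blast
  moreover have "range (\<lambda>_ :: nat. \<phi>) \<subseteq> lang E M" using assms(3) by blast
  ultimately have "true_at E M (map_modal (\<lambda>_ :: nat. \<phi>) (MImp (Dia (Box (Atom 0))) (Atom 0)))"
    unfolding Val_def by blast
  then have "true_at E M (Dia (Box (Atom \<phi>))) \<longrightarrow> models E (ext E M) \<phi>"
    by (simp del: true_at.simps(4,5))
  then show ?thesis
    using assms(4) by (simp add: true_at_Dia_Box[OF assms(1)] del: true_at.simps(4,5))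
qed

lemma S5_reflects_sat:
  assumes "trans_set E M" and "S5 \<subseteq> Val E M (lang E M)" and "denotations e \<phi> \<subseteq> ext E M"
    and "\<forall>\<^sub>F U in large_worlds E. sat E (ext E U) e \<phi>"
  shows "sat E (ext E M) e \<phi>"
  using S5_reflects_models[OF assms(1,2) close_in_lang[OF assms(3)]] assms(4)
  unfolding models_close .

lemma Sigma2_upward_if_S5:
  assumes M: "trans_set E M" and S5: "S5 \<subseteq> Val E M (lang E M)"
    and "Sigma_fm 2 \<phi>" and "denotations e \<phi> \<subseteq> ext E M" and "sat E (ext E M) e \<phi>"
  shows "sat E UNIV e \<phi>"
  using assms(3-5) unfolding numeral_2_eq_2
proof (induction arbitrary: e rule: Sigma_fm_Suc_induct)
  case (Pi \<phi>)
  show ?case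
  proof (rule ccontr)
    assume "\<not> sat E UNIV e \<phi>"
    then have "\<forall>\<^sub>F U in large_worlds E. sat E (ext E U) e (FNeg \<phi>)"
      using Pi1_eventually_false Pi(1) by simp
    then have "sat E (ext E M) e (FNeg \<phi>)"
      using S5_reflects_sat[OF M S5] Pi(2) by (simp only: denotations_simps)
    then show False using Pi(3) by simp
  qed
next
  case (Ex k \<phi>)
  then obtain x where x: "x \<in> ext E M" "sat E (ext E M) (e(k := x)) \<phi>" by auto
  then have "denotations (e(k := x)) \<phi> \<subseteq> ext E M"
    using Ex.prems(1) denotations_upd(1)[of e k x \<phi>] by blast
  then show ?case using Ex.IH x(2) by auto
qed

lemma Sigma_elementary_if_S5:
  assumes M: "trans_set E M" and S5: "S5 \<subseteq> Val E M (lang E M)"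
  shows "Sigma_elementary E 2 M"
  unfolding Sigma_elementary_def
proof (intro ballI impI)
  fix \<phi> assume "\<phi> \<in> lang E M" and \<phi>: "Sigma_fm 2 \<phi>"
  then have closed: "fv \<phi> = {}" and denotations: "denotations e \<phi> \<subseteq> ext E M" for e
    by (auto simp: lang_def denotations_def)
  show "models E (ext E M) \<phi> \<longleftrightarrow> models E UNIV \<phi>"
    unfolding models_iff_sat[OF closed, where e = undefined]
    using Sigma2_upward_if_S5[OF M S5 \<phi> denotations]
      S5_reflects_sat[OF M S5 denotations Sigma2_eventually[OF \<phi>]] by blast
qed

end

section \<open>\<open>\<Sigma>\<^sub>2\<close>-elementary transitive sets\<close>

lemma Sigma_elementary_sat:
  assumes "Sigma_elementary E n M" and "Sigma_fm n \<phi>" and "denotations e \<phi> \<subseteq> ext E M"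
  shows "sat E (ext E M) e \<phi> \<longleftrightarrow> sat E UNIV e \<phi>"
  using assms Sigma_fm_close[of n \<phi> e] close_in_lang[of e \<phi> E M]
  unfolding Sigma_elementary_def models_close[symmetric, of E _ e \<phi>] by blast

lemma Sigma_elementary_nonempty:
  assumes "Sigma_elementary E (Suc n) M"
  shows "\<exists>m. E m M"
proof -
  let ?\<phi> = "FEx 0 (FEq (Var 0) (Var 0)) :: 'a fm"
  have "Sigma_fm (Suc n) ?\<phi>"
    by (intro Sigma_fm_Pi_fm.intros conjunct2[OF Levy_Delta0] Delta0_fm.intros)
  then have "sat E (ext E M) undefined ?\<phi> \<longleftrightarrow> sat E UNIV undefined ?\<phi>"
    using assms by (intro Sigma_elementary_sat) (auto simp: denotations_def)
  then show ?thesis by (simp add: ext_def)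
qed

lemma Sigma_elementary_witness:
  assumes M: "Sigma_elementary E (Suc n) M"
    and Q: "definable E (Sigma_fm (Suc n)) (ext E M) (\<lambda>e. Q (e 0))" and "Q x"
  shows "\<exists>x. E x M \<and> Q x"
proof -
  obtain m where m: "E m M" using Sigma_elementary_nonempty[OF M] by blast
  obtain \<phi> where \<phi>: "Sigma_fm (Suc n) \<phi>" "params \<phi> \<subseteq> ext E M" "\<And>e. sat E UNIV e \<phi> \<longleftrightarrow> Q (e 0)"
    using Q unfolding definable_def by blast
  define e where "e = (\<lambda>_ :: nat. m)"
  have denotations: "denotations (e(0 := y)) \<phi> \<subseteq> ext E M" if "E y M" for y
    using \<phi>(2) m that by (auto simp: denotations_def e_def ext_def)
  have "sat E UNIV e (FEx 0 \<phi>)" using \<phi>(3) \<open>Q x\<close> by auto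
  moreover have "denotations e (FEx 0 \<phi>) \<subseteq> ext E M"
    using \<phi>(2) m by (auto simp: denotations_def e_def ext_def)
  ultimately have "sat E (ext E M) e (FEx 0 \<phi>)"
    using Sigma_elementary_sat[OF M Sigma_fm_FEx[OF \<phi>(1)]] by blast
  then obtain y where y: "E y M" "sat E (ext E M) (e(0 := y)) \<phi>" by (auto simp: ext_def)
  then have "Q y" using Sigma_elementary_sat[OF M \<phi>(1) denotations] \<phi>(3)[of "e(0 := y)"] by simp
  with y(1) show ?thesis by blast
qed

context ZFC
begin

lemmas Sigma2_definable_intros =
  Sigma_definable_ex definable_Sigma_if_Pi Pi_definable_all definable_Pi_if_Delta0
  definable_connectives[OF Delta0_closed_Delta0] definable_set_notions[OF Delta0_closed_Delta0]
  definable_level_matrix[OF Delta0_closed_Delta0 definable_rel_subset[OF Delta0_closed_Delta0]]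
  definable_term_Var definable_term_Par

text \<open>
  As in Mostowski's lemma, \<open>g\<close> collapses \<open>(b, R)\<close> onto \<open>(c, \<in>)\<close>. That \<open>g\<close> takes only one value in
  \<open>c\<close> at each element of \<open>b\<close> follows from \<open>g\<close> respecting \<open>R\<close> and need not be required.
\<close>

definition is_collapse :: "'a \<Rightarrow> 'a \<Rightarrow> 'a \<Rightarrow> 'a \<Rightarrow> bool" where
  "is_collapse g R b c \<longleftrightarrow> trans_set E c \<and>
    (\<forall>x. E x b \<longrightarrow> (\<exists>u. E u c \<and> maps_to E g x u)) \<and>
    (\<forall>u. E u c \<longrightarrow> (\<exists>x. E x b \<and> maps_to E g x u)) \<and>
    (\<forall>x. E x b \<longrightarrow> (\<forall>y. E y b \<longrightarrow> (\<forall>u. E u c \<longrightarrow> (\<forall>v. E v c \<longrightarrow>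
      maps_to E g x u \<longrightarrow> maps_to E g y v \<longrightarrow> (maps_to E R x y \<longleftrightarrow> E u v)))))"

lemma is_collapse_value: "is_collapse g R b c \<Longrightarrow> E x b \<Longrightarrow> \<exists>u. E u c \<and> maps_to E g x u"
  unfolding is_collapse_def by blast

lemma is_collapse_preimage: "is_collapse g R b c \<Longrightarrow> E u c \<Longrightarrow> \<exists>x. E x b \<and> maps_to E g x u"
  unfolding is_collapse_def by blast

lemma is_collapse_iff:
  "is_collapse g R b c \<Longrightarrow> E x b \<Longrightarrow> E y b \<Longrightarrow> E u c \<Longrightarrow> E v c \<Longrightarrow> maps_to E g x u \<Longrightarrow> maps_to E g y v \<Longrightarrow>
    maps_to E R x y \<longleftrightarrow> E u v"
  unfolding is_collapse_def by blast

lemma is_collapse_trans_set: "is_collapse g R b c \<Longrightarrow> trans_set E c"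
  unfolding is_collapse_def by blast

lemma is_collapse_mem_cong:
  assumes "is_collapse f R b c" and "is_collapse g R b d" and "E x b" and "E y b"
    and "E w c" "maps_to E f x w" "E z c" "maps_to E f y z"
    and "E u d" "maps_to E g x u" "E v d" "maps_to E g y v"
  shows "E z w \<longleftrightarrow> E v u"
  using is_collapse_iff[OF assms(1), of y x z w] is_collapse_iff[OF assms(2), of y x v u] assms(3-)
  by blast

lemma is_collapse_agree:
  assumes f: "is_collapse f R b c" and g: "is_collapse g R b d" and w: "E w c"
    and "E x b" "maps_to E f x w" "E u d" "maps_to E g x u"
  shows "u = w"
proof -
  define agree where "agree w \<longleftrightarrow>
    (\<forall>x u. E x b \<and> maps_to E f x w \<and> E u d \<and> maps_to E g x u \<longrightarrow> u = w)" for w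
  note c = is_collapse_trans_set[OF f] and d = is_collapse_trans_set[OF g]
  have "agree w"
  proof (rule trans_set_induct[OF _ c w])
    show "fo_definable E (\<lambda>e. agree (e 0))"
      unfolding agree_def by (intro fo_definable_set_intros)
  next
    fix w assume w: "E w c" and IH: "\<And>z. E z w \<Longrightarrow> agree z"
    show "agree w"
      unfolding agree_def
    proof (intro allI impI set_eqI iffI)
      fix x u z assume x: "E x b \<and> maps_to E f x w \<and> E u d \<and> maps_to E g x u" and "E z u"
      then have z: "E z d" using trans_set_mem[OF d] by blast
      then obtain y where y: "E y b" "maps_to E g y z" using is_collapse_preimage[OF g] by blast
      obtain z' where "E z' c" "maps_to E f y z'" using is_collapse_value[OF f y(1)] by blast
      moreover then have "E z' w" using is_collapse_mem_cong[OF f g] x y z w \<open>E z u\<close> by blast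
      ultimately show "E z w" using IH y z unfolding agree_def by blast
    next
      fix x u z assume x: "E x b \<and> maps_to E f x w \<and> E u d \<and> maps_to E g x u" and "E z w"
      then have z: "E z c" using trans_set_mem[OF c w] by blast
      then obtain y where y: "E y b" "maps_to E f y z" using is_collapse_preimage[OF f] by blast
      obtain z' where "E z' d" "maps_to E g y z'" using is_collapse_value[OF g y(1)] by blast
      moreover then have "E z' u" using is_collapse_mem_cong[OF f g] x y z w \<open>E z w\<close> by blast
      ultimately show "E z u" using IH[OF \<open>E z w\<close>] y unfolding agree_def by blast
    qed
  qed
  with assms show ?thesis unfolding agree_def by blast
qed

lemma is_collapse_unique:
  assumes f: "is_collapse f R b c" and g: "is_collapse g R b d"
  shows "c = d"
proof (rule set_eqI, rule iffI)
  fix z assume z: "E z c"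
  then obtain x where "E x b" "maps_to E f x z" using is_collapse_preimage[OF f] by blast
  moreover then obtain u where "E u d" "maps_to E g x u" using is_collapse_value[OF g] by blast
  ultimately show "E z d" using is_collapse_agree[OF f g z] by blast
next
  fix z assume z: "E z d"
  then obtain x where "E x b" "maps_to E g x z" using is_collapse_preimage[OF g] by blast
  moreover then obtain u where "E u c" "maps_to E f x u" using is_collapse_value[OF f] by blast
  ultimately show "E z c" using is_collapse_agree[OF g f z] by blast
qed

context
  fixes M
  assumes M: "trans_set E M" and elementary: "Sigma_elementary E 2 M"
begin

lemmas elementary_witness = Sigma_elementary_witness[OF elementary[unfolded numeral_2_eq_2]]

lemma power_set_in_M:
  assumes "E a M"
  shows "\<exists>p. E p M \<and> (\<forall>y. E y p \<longleftrightarrow> subset E y a)"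
proof -
  have "a \<in> ext E M" using assms by (simp add: ext_def)
  then have "definable E (Sigma_fm (Suc (Suc 0))) (ext E M) (\<lambda>e. \<forall>y. E y (e 0) \<longleftrightarrow> subset E y a)"
    by (intro Sigma2_definable_intros)
  moreover obtain p where "\<forall>y. E y p \<longleftrightarrow> subset E y a" using power_set by blast
  ultimately show ?thesis by (rule elementary_witness)
qed

lemma subset_in_M: "E a M \<Longrightarrow> subset E y a \<Longrightarrow> E y M"
  using power_set_in_M trans_set_mem[OF M] by blast

lemma V_in_M:
  assumes "E \<alpha> M" and V: "is_V E \<alpha> v"
  shows "E v M"
proof -
  have "\<alpha> \<in> ext E M" using assms by (simp add: ext_def)
  then have "definable E (Sigma_fm (Suc (Suc 0))) (ext E M) (\<lambda>e. is_V E \<alpha> (e 0))"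
    unfolding is_V_iff_level level_iff_matrix by (intro Sigma2_definable_intros)
  then obtain v' where "E v' M" "is_V E \<alpha> v'" using elementary_witness[of "is_V E \<alpha>"] V by blast
  then show ?thesis using V_unique[OF V] by blast
qed

lemma V_includes_in_M:
  assumes "E x M"
  shows "\<exists>\<alpha>. E \<alpha> M \<and> V_includes \<alpha> x"
proof -
  have "V_includes \<alpha> x \<longleftrightarrow> (\<exists>v f t. \<forall>z. level_matrix (subset E) f t \<alpha> v z \<and> subset E x v)" for \<alpha>
    unfolding V_includes_def is_V_iff_level level_iff_matrix by simp
  moreover have "x \<in> ext E M" using assms by (simp add: ext_def)
  then have "definable E (Sigma_fm (Suc (Suc 0))) (ext E M)
      (\<lambda>e. \<exists>v f t. \<forall>z. level_matrix (subset E) f t (e 0) v z \<and> subset E x v)"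
    by (intro Sigma2_definable_intros)
  ultimately have "definable E (Sigma_fm (Suc (Suc 0))) (ext E M) (\<lambda>e. V_includes (e 0) x)" by simp
  moreover obtain \<alpha> where "V_includes \<alpha> x" using V_covers by blast
  ultimately show ?thesis by (rule elementary_witness)
qed

lemma elementary_is_V: "\<exists>\<delta>. is_V E \<delta> M \<and> (\<forall>\<alpha>. E \<alpha> \<delta> \<longleftrightarrow> E \<alpha> M \<and> is_ordinal E \<alpha>)"
proof -
  have "small (\<lambda>\<alpha>. E \<alpha> M \<and> is_ordinal E \<alpha>)" by (intro small_separation fo_definable_set_intros)
  then obtain \<delta> where \<delta>: "\<And>\<alpha>. E \<alpha> \<delta> \<longleftrightarrow> E \<alpha> M \<and> is_ordinal E \<alpha>" unfolding small_def by blast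
  have "is_ordinal E \<delta>"
    by (rule ordinalI) (use \<delta> trans_set_mem[OF M] ordinal_mem in blast)+
  then obtain v where v: "is_V E \<delta> v" using V_exists by blast
  have "v = M"
  proof (rule set_eqI, rule iffI)
    fix x assume "E x v"
    then obtain \<gamma> w where "E \<gamma> M" "is_V E \<gamma> w" "subset E x w" using V_iff[OF v] \<delta> by blast
    then show "E x M" using V_in_M subset_in_M by blast
  next
    fix x assume "E x M"
    then obtain \<alpha> where "E \<alpha> M" "V_includes \<alpha> x" using V_includes_in_M by blast
    moreover then have "E \<alpha> \<delta>" using \<delta> V_includes_ordinal by blast
    ultimately show "E x v" using V_iff[OF v] unfolding V_includes_def by blast
  qed
  then show ?thesis using v \<delta> by blast
qed

lemma relation_in_M:
  assumes Q: "fo_definable_rel E Q" and "E b M"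
  shows "\<exists>R. E R M \<and> (\<forall>x y. maps_to E R x y \<longleftrightarrow> E x b \<and> E y b \<and> Q x y)"
proof -
  obtain p where p: "E p M" "\<And>y. E y p \<longleftrightarrow> subset E y b" using power_set_in_M[OF \<open>E b M\<close>] by blast
  obtain q where q: "E q M" "\<And>y. E y q \<longleftrightarrow> subset E y p" using power_set_in_M[OF p(1)] by blast
  have pairs: "E (opair x y) q" if "E x b" "E y b" for x y
    using that by (auto simp: q p subset_def opair_def mem_upair)
  have "small (\<lambda>r. E r q \<and> (\<exists>x y. is_opair E x y r \<and> E x b \<and> E y b \<and> Q x y))"
    by (intro small_separation fo_definable_set_intros definable_relD[OF Q])
  then obtain R where R: "\<And>r. E r R \<longleftrightarrow> E r q \<and> (\<exists>x y. is_opair E x y r \<and> E x b \<and> E y b \<and> Q x y)"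
    unfolding small_def by blast
  have "E R M" using subset_in_M[OF q(1)] R unfolding subset_def by blast
  moreover have "maps_to E R x y \<longleftrightarrow> E x b \<and> E y b \<and> Q x y" for x y
    unfolding maps_to_iff R is_opair_iff opair_eq using pairs by blast
  ultimately show ?thesis by blast
qed

text \<open>
  A bijection \<open>f : \<beta> \<rightarrow> \<delta>\<close> induces a well-order \<open>R \<in> M\<close> of \<open>\<beta>\<close> of type \<open>\<delta>\<close>; by elementarity \<open>R\<close> is
  isomorphic to some \<open>\<gamma> \<in> M\<close> as well, and uniqueness of the collapse gives \<open>\<gamma> = \<delta>\<close>.
\<close>

lemma bijective_ordinal_in_M:
  assumes \<beta>: "E \<beta> M" and \<delta>: "is_ordinal E \<delta>" and bij: "is_bijection E f \<beta> \<delta>"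
  shows "E \<delta> M"
proof -
  define Q where "Q x y \<longleftrightarrow> (\<exists>u v. maps_to E f x u \<and> maps_to E f y v \<and> E u v)" for x y
  have "fo_definable_rel E Q"
    unfolding Q_def by (intro definable_relI fo_definable_set_intros)
  then obtain R where "E R M" and R: "\<And>x y. maps_to E R x y \<longleftrightarrow> E x \<beta> \<and> E y \<beta> \<and> Q x y"
    using relation_in_M \<beta> by blast
  have unique: "u = u'" if "maps_to E f x u" "maps_to E f x u'" for x u u'
    using that bij is_function_maps_to_dom unfolding is_bijection_def is_function_def by blast
  have "is_collapse f R \<beta> \<delta>"
    unfolding is_collapse_def
  proof (intro conjI allI impI)
    show "trans_set E \<delta>" using \<delta> unfolding is_ordinal_def by blast
    show "\<exists>u. E u \<delta> \<and> maps_to E f x u" if "E x \<beta>" for x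
      using that bij unfolding is_bijection_def is_function_def by blast
    show "\<exists>x. E x \<beta> \<and> maps_to E f x u" if "E u \<delta>" for u
      using that bij is_function_maps_to_dom unfolding is_bijection_def by blast
    show "maps_to E R x y \<longleftrightarrow> E u v"
      if "E x \<beta>" "E y \<beta>" "maps_to E f x u" "maps_to E f y v" for x y u v
      using that unique unfolding R Q_def by blast
  qed
  moreover have "definable E (Sigma_fm (Suc (Suc 0))) (ext E M) (\<lambda>e. \<exists>g. is_collapse g R \<beta> (e 0))"
  proof -
    have "R \<in> ext E M" "\<beta> \<in> ext E M" using \<open>E R M\<close> \<beta> by (simp_all add: ext_def)
    then show ?thesis unfolding is_collapse_def by (intro Sigma2_definable_intros)
  qed
  ultimately obtain \<gamma> g where "E \<gamma> M" "is_collapse g R \<beta> \<gamma>"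
    using elementary_witness[of "\<lambda>\<gamma>. \<exists>g. is_collapse g R \<beta> \<gamma>"] by blast
  then show ?thesis using is_collapse_unique \<open>is_collapse f R \<beta> \<delta>\<close> by blast
qed

lemma is_cardinal_height:
  assumes \<delta>: "\<And>\<alpha>. E \<alpha> \<delta> \<longleftrightarrow> E \<alpha> M \<and> is_ordinal E \<alpha>" and ordinal: "is_ordinal E \<delta>"
  shows "is_cardinal E \<delta>"
proof -
  have "\<not> E \<delta> M" using \<delta> ordinal mem_irrefl by blast
  then show ?thesis unfolding is_cardinal_def using ordinal \<delta> bijective_ordinal_in_M by blast
qed

end

lemma Sigma_elementary_iff_Sigma_correct:
  assumes M: "trans_set E M"
  shows "Sigma_elementary E 2 M \<longleftrightarrow> (\<exists>\<delta>. Sigma_correct_cardinal E 2 \<delta> \<and> is_V E \<delta> M)"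
proof
  assume elementary: "Sigma_elementary E 2 M"
  obtain \<delta> where V: "is_V E \<delta> M" and \<delta>: "\<And>\<alpha>. E \<alpha> \<delta> \<longleftrightarrow> E \<alpha> M \<and> is_ordinal E \<alpha>"
    using elementary_is_V[OF M elementary] by blast
  have "is_cardinal E \<delta>" by (rule is_cardinal_height[OF M elementary \<delta> V_ordinal[OF V]])
  then show "\<exists>\<delta>. Sigma_correct_cardinal E 2 \<delta> \<and> is_V E \<delta> M"
    using V elementary unfolding Sigma_correct_cardinal_def by blast
next
  assume "\<exists>\<delta>. Sigma_correct_cardinal E 2 \<delta> \<and> is_V E \<delta> M"
  then show "Sigma_elementary E 2 M" unfolding Sigma_correct_cardinal_def using V_unique by blast
qed

end

section \<open>\<open>\<Sigma>\<^sub>2\<close>-elementarity implies validity of S5\<close>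

definition FOr :: "'a fm \<Rightarrow> 'a fm \<Rightarrow> 'a fm" where
  "FOr \<phi> \<psi> = FNeg (FAnd (FNeg \<phi>) (FNeg \<psi>))"

lemma models_FOr:
  "fv \<phi> = {} \<Longrightarrow> fv \<psi> = {} \<Longrightarrow> models E D (FOr \<phi> \<psi>) \<longleftrightarrow> models E D \<phi> \<or> models E D \<psi>"
  by (simp add: FOr_def models_FNeg models_FAnd)

lemma FNeg_in_lang: "\<phi> \<in> lang E A \<Longrightarrow> FNeg \<phi> \<in> lang E A"
  by (simp add: lang_def)

lemma FAnd_in_lang: "\<phi> \<in> lang E A \<Longrightarrow> \<psi> \<in> lang E A \<Longrightarrow> FAnd \<phi> \<psi> \<in> lang E A"
  by (auto simp: lang_def)

lemma FOr_in_lang: "\<phi> \<in> lang E A \<Longrightarrow> \<psi> \<in> lang E A \<Longrightarrow> FOr \<phi> \<psi> \<in> lang E A"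
  by (auto simp: lang_def FOr_def)

lemma ex_constant_sentence: "\<exists>\<chi>\<in>lang E A. \<forall>D. models E D \<chi> \<longleftrightarrow> b"
proof -
  let ?\<tau> = "FAll 0 (FEq (Var 0) (Var 0)) :: 'a fm"
  have "?\<tau> \<in> lang E A" "FNeg ?\<tau> \<in> lang E A" by (simp_all add: lang_def)
  moreover have "models E D ?\<tau>" "\<not> models E D (FNeg ?\<tau>)" for D by (simp_all add: models_def)
  ultimately show ?thesis by (cases b) blast+
qed

lemma true_at_map_modal_tautology:
  assumes "tautology p"
  shows "true_at E W (map_modal \<sigma> p)"
proof -
  have "bool_eval (\<lambda>q. true_at E W (map_modal \<sigma> q)) p \<longleftrightarrow> true_at E W (map_modal \<sigma> p)"
    by (induction p) auto
  then show ?thesis using assms unfolding tautology_def by blast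
qed

context ZFC
begin

definition expressible_above :: "'a \<Rightarrow> ('a \<Rightarrow> bool) \<Rightarrow> bool" where
  "expressible_above M P \<longleftrightarrow>
    (\<exists>\<psi>\<in>lang E M. \<forall>U\<in>extensions E M. P U \<longleftrightarrow> models E (ext E U) \<psi>)"

lemma expressible_above_constant:
  assumes "(\<forall>U\<in>extensions E M. P U) \<or> (\<forall>U\<in>extensions E M. \<not> P U)"
  shows "expressible_above M P"
proof -
  obtain b where "\<And>U. U \<in> extensions E M \<Longrightarrow> P U \<longleftrightarrow> b" using assms by blast
  moreover obtain \<psi> where "\<psi> \<in> lang E M" "\<And>D. models E D \<psi> \<longleftrightarrow> b"
    using ex_constant_sentence by metis
  ultimately show ?thesis unfolding expressible_above_def by blast
qed

lemma expressible_above_imp: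
  assumes "expressible_above M P" and "expressible_above M Q"
  shows "expressible_above M (\<lambda>U. P U \<longrightarrow> Q U)"
proof -
  obtain \<phi> where \<phi>: "\<phi> \<in> lang E M" "\<forall>U\<in>extensions E M. P U \<longleftrightarrow> models E (ext E U) \<phi>"
    using assms(1) unfolding expressible_above_def by blast
  obtain \<psi> where \<psi>: "\<psi> \<in> lang E M" "\<forall>U\<in>extensions E M. Q U \<longleftrightarrow> models E (ext E U) \<psi>"
    using assms(2) unfolding expressible_above_def by blast
  have "fv \<phi> = {}" "fv \<psi> = {}" using \<phi>(1) \<psi>(1) by (simp_all add: lang_def)
  then have "\<forall>U\<in>extensions E M. (P U \<longrightarrow> Q U) \<longleftrightarrow> models E (ext E U) (FOr (FNeg \<phi>) \<psi>)"
    using \<phi>(2) \<psi>(2) by (simp add: models_FOr models_FNeg)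
  then show ?thesis
    unfolding expressible_above_def using FOr_in_lang[OF FNeg_in_lang[OF \<phi>(1)] \<psi>(1)] by blast
qed

lemma expressible_above_not:
  "expressible_above M P \<Longrightarrow> expressible_above M (\<lambda>U. \<not> P U)"
  using expressible_above_imp[OF _ expressible_above_constant, of M P "\<lambda>_. False"] by simp

lemma elementary_reflects_models:
  assumes M: "trans_set E M" and elementary: "Sigma_elementary E 2 M" and \<phi>: "\<phi> \<in> lang E M"
    and ev: "\<forall>\<^sub>F U in large_worlds E. models E (ext E U) \<phi>" and U: "U \<in> extensions E M"
  shows "models E (ext E U) \<phi>"
proof -
  have closed: "fv \<phi> = {}" and params: "params \<phi> \<subseteq> ext E M" using \<phi> by (auto simp: lang_def)
  have sat: "sat E D e \<phi> \<longleftrightarrow> models E D \<phi>" for D e by (simp add: models_iff_sat[OF closed, of E D e])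
  define Q where "Q W \<longleftrightarrow> (\<forall>U. trans_set E W \<and>
    (trans_set E U \<and> subset E W U \<longrightarrow> sat E (ext E U) (\<lambda>_. U) \<phi>))" for W
  have "definable E (Sigma_fm (Suc (Suc 0))) (ext E M) (\<lambda>e. Q (e 0))"
    unfolding Q_def
    by (intro Sigma2_definable_intros definable_relativized[OF Delta0_closed_Delta0] params)
  moreover obtain W where "Q W"
    using ev by (auto simp: Q_def eventually_large_worlds extensions_def sat)
  ultimately obtain W where W: "E W M" "Q W"
    using Sigma_elementary_witness[OF elementary[unfolded numeral_2_eq_2]] by blast
  have "E W U" using W(1) U unfolding extensions_def subset_def by blast
  then have "trans_set E U \<and> subset E W U" using U unfolding extensions_def trans_set_def by blast
  then show ?thesis using W(2) by (simp add: Q_def sat)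
qed

context
  fixes M
  assumes M: "trans_set E M" and elementary: "Sigma_elementary E 2 M"
begin

lemma eventually_iff_everywhere_above:
  assumes "expressible_above M P"
  shows "(\<forall>\<^sub>F U in large_worlds E. P U) \<longleftrightarrow> (\<forall>U\<in>extensions E M. P U)"
proof
  obtain \<psi> where \<psi>: "\<psi> \<in> lang E M" "\<forall>U\<in>extensions E M. P U \<longleftrightarrow> models E (ext E U) \<psi>"
    using assms unfolding expressible_above_def by blast
  assume "\<forall>\<^sub>F U in large_worlds E. P U"
  with eventually_extensions[OF M] have "\<forall>\<^sub>F U in large_worlds E. models E (ext E U) \<psi>"
    by eventually_elim (simp add: \<psi>(2))
  then show "\<forall>U\<in>extensions E M. P U"
    using elementary_reflects_models[OF M elementary \<psi>(1)] \<psi>(2) by blast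
qed (use M in \<open>auto simp: eventually_large_worlds\<close>)

text \<open>
  If a boxed assertion holds at some world above \<open>M\<close>, the assertion holds in all large worlds and
  hence everywhere above \<open>M\<close>.
\<close>

lemma expressible_above_Box:
  assumes "expressible_above M (\<lambda>U. true_at E U p)"
  shows "expressible_above M (\<lambda>U. true_at E U (Box p))"
proof (rule expressible_above_constant, cases "\<forall>U\<in>extensions E M. true_at E U p")
  case True
  then show "(\<forall>U\<in>extensions E M. true_at E U (Box p)) \<or> (\<forall>U\<in>extensions E M. \<not> true_at E U (Box p))"
    unfolding true_at_Box using extensions_trans by fast
next
  case False
  then have "\<not> (\<forall>\<^sub>F U in large_worlds E. true_at E U p)"
    by (simp add: eventually_iff_everywhere_above[OF assms])
  then show "(\<forall>U\<in>extensions E M. true_at E U (Box p)) \<or> (\<forall>U\<in>extensions E M. \<not> true_at E U (Box p))"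
    unfolding true_at_Box eventually_large_worlds_above[OF M] by blast
qed

lemma modal_assertion_expressible_above:
  "set_modal p \<subseteq> lang E M \<Longrightarrow> expressible_above M (\<lambda>U. true_at E U p)"
proof (induction p)
  case (Atom \<phi>)
  then show ?case by (auto simp: expressible_above_def)
next
  case MBot
  show ?case by (rule expressible_above_constant) simp
next
  case (MImp p q)
  then show ?case by (simp add: expressible_above_imp)
next
  case (Box p)
  then show ?case by (intro expressible_above_Box) simp
next
  case (Dia p)
  then have "expressible_above M (\<lambda>U. true_at E U (MNeg p))"
    by (simp add: MNeg_def expressible_above_not)
  then have "expressible_above M (\<lambda>U. \<not> true_at E U (Box (MNeg p)))"
    by (intro expressible_above_not expressible_above_Box)
  moreover have "true_at E U (Dia p) \<longleftrightarrow> \<not> true_at E U (Box (MNeg p))" for U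
    by (auto simp: MNeg_def)
  ultimately show ?case by simp
qed

lemma S5_true_above:
  assumes \<sigma>: "range \<sigma> \<subseteq> lang E M"
  shows "p \<in> S5 \<Longrightarrow> U \<in> extensions E M \<Longrightarrow> true_at E U (map_modal \<sigma> p)"
proof (induction arbitrary: U rule: S5.induct)
  case (taut p)
  then show ?case by (intro true_at_map_modal_tautology)
next
  case (Five p)
  have "set_modal (map_modal \<sigma> p) \<subseteq> lang E M" using \<sigma> by (auto simp: modal.set_map)
  then have expressible: "expressible_above M (\<lambda>U. true_at E U (map_modal \<sigma> p))"
    by (rule modal_assertion_expressible_above)
  have "trans_set E U" using Five by (simp add: extensions_def)
  then have "true_at E U (Dia (Box (map_modal \<sigma> p))) \<longrightarrow> true_at E U (map_modal \<sigma> p)"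
    unfolding true_at_Dia_Box[OF \<open>trans_set E U\<close>]
    using eventually_iff_everywhere_above[OF expressible] Five.prems by blast
  then show ?case by (simp del: true_at.simps(4,5))
next
  case (T p)
  then show ?case by (simp add: extensions_def subset_def)
next
  case (Four p)
  then show ?case by (simp add: subset_def)
next
  case (Nec p)
  then show ?case by (simp add: extensions_def subset_def)
qed (auto simp: MNeg_def)

lemma S5_if_Sigma_elementary: "S5 \<subseteq> Val E M (lang E M)"
  using S5_true_above extensions_refl[OF M] unfolding Val_def by blast

end

end

section \<open>No validities beyond S5\<close>

lemma true_at_iff_kripke_sat:
  assumes "\<And>n U. U \<in> extensions E W \<Longrightarrow> models E (ext E U) (\<sigma> n) \<longleftrightarrow> v U n"
    and "\<And>U. U \<in> extensions E W \<Longrightarrow> v ` extensions E U = T"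
    and "U \<in> extensions E W"
  shows "true_at E U (map_modal \<sigma> p) \<longleftrightarrow> kripke_sat T (v U) p"
  using assms(3)
proof (induction p arbitrary: U)
  case (Atom n)
  then show ?case by (simp add: assms(1))
next
  case (Box p)
  have IH: "true_at E U' (map_modal \<sigma> p) \<longleftrightarrow> kripke_sat T (v U') p" if "U' \<in> extensions E U" for U'
    using Box.IH extensions_trans[OF Box.prems that] .
  have "true_at E U (map_modal \<sigma> (Box p)) \<longleftrightarrow> (\<forall>U'\<in>extensions E U. kripke_sat T (v U') p)"
    unfolding modal.map true_at_Box using IH by blast
  also have "\<dots> \<longleftrightarrow> (\<forall>u\<in>v ` extensions E U. kripke_sat T u p)" by simp
  also have "\<dots> \<longleftrightarrow> kripke_sat T (v U) (Box p)" by (simp add: assms(2)[OF Box.prems])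
  finally show ?case .
next
  case (Dia p)
  have IH: "true_at E U' (map_modal \<sigma> p) \<longleftrightarrow> kripke_sat T (v U') p" if "U' \<in> extensions E U" for U'
    using Dia.IH extensions_trans[OF Dia.prems that] .
  have "true_at E U (map_modal \<sigma> (Dia p)) \<longleftrightarrow> (\<exists>U'\<in>extensions E U. kripke_sat T (v U') p)"
    unfolding modal.map true_at_Dia using IH by blast
  also have "\<dots> \<longleftrightarrow> (\<exists>u\<in>v ` extensions E U. kripke_sat T u p)" by simp
  also have "\<dots> \<longleftrightarrow> kripke_sat T (v U) (Dia p)" by (simp add: assms(2)[OF Dia.prems])
  finally show ?case .
qed auto

definition FIff :: "'a fm \<Rightarrow> 'a fm \<Rightarrow> 'a fm" where
  "FIff \<phi> \<psi> = FAnd (FImp \<phi> \<psi>) (FImp \<psi> \<phi>)"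

text \<open>The variable \<open>n\<close> denotes the \<open>k\<close>-th successor of a set without \<open>\<in>\<close>-maximal element.\<close>

fun successor_fm :: "nat \<Rightarrow> nat \<Rightarrow> 'a fm" where
  "successor_fm 0 n = FAll (n + 1) (FImp (FMem (Var (n + 1)) (Var n))
    (FEx (n + 2) (FAnd (FMem (Var (n + 2)) (Var n)) (FMem (Var (n + 1)) (Var (n + 2))))))"
| "successor_fm (Suc k) n = FEx (n + 1) (FAnd
    (FAll (n + 2) (FIff (FMem (Var (n + 2)) (Var n))
      (FOr (FMem (Var (n + 2)) (Var (n + 1))) (FEq (Var (n + 2)) (Var (n + 1))))))
    (successor_fm k (n + 1)))"

definition dial_fm :: "nat \<Rightarrow> 'a fm" where
  "dial_fm k = FEx 0 (FAnd (FAll 1 (FNeg (FMem (Var 0) (Var 1)))) (successor_fm k 0))"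

lemma fv_successor_fm: "fv (successor_fm k n) \<subseteq> {n}"
proof (induction k arbitrary: n)
  case (Suc k)
  then show ?case using Suc.IH[of "n + 1"] by (auto simp: FImp_def FOr_def FIff_def)
qed (auto simp: FImp_def)

lemma params_successor_fm: "params (successor_fm k n) = {}"
  by (induction k arbitrary: n) (auto simp: FImp_def FOr_def FIff_def)

lemma dial_fm_in_lang: "dial_fm k \<in> lang E A"
  using fv_successor_fm[of k 0] by (auto simp: lang_def dial_fm_def params_successor_fm)

context ZFC
begin

lemma not_unbounded_succ: "\<not> unbounded (succ x)"
  unfolding unbounded_def mem_succ using mem_asym by blast

lemma succ_funpow_unbounded_inject:
  "unbounded x \<Longrightarrow> unbounded y \<Longrightarrow> (succ ^^ j) x = (succ ^^ k) y \<Longrightarrow> j = k"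
proof (induction j arbitrary: k)
  case 0
  then show ?case using not_unbounded_succ by (cases k) auto
next
  case (Suc j)
  then show ?case using not_unbounded_succ by (cases k) (auto simp: succ_inject)
qed

lemma sat_successor_fm:
  assumes U: "trans_set E U" and "E (e n) U"
  shows "sat E (ext E U) e (successor_fm k n) \<longleftrightarrow> (\<exists>y. unbounded y \<and> e n = (succ ^^ k) y)"
  using assms(2)
proof (induction k arbitrary: e n)
  case 0
  then show ?case using trans_set_mem[OF U] by (auto simp: unbounded_def FImp_def ext_def)
next
  case (Suc k)
  have succ_iff: "e n = succ y \<longleftrightarrow> (\<forall>z. E z U \<longrightarrow> (E z (e n) \<longleftrightarrow> E z y \<or> z = y))" if "E y U" for y
    using trans_set_mem[OF U Suc.prems] trans_set_mem[OF U that] that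
    unfolding is_succ_iff[symmetric] is_succ_def by blast
  have "sat E (ext E U) e (successor_fm (Suc k) n) \<longleftrightarrow>
      (\<exists>y. E y U \<and> e n = succ y \<and> (\<exists>x. unbounded x \<and> y = (succ ^^ k) x))"
    using Suc.IH[of _ "n + 1"] succ_iff by (simp add: FImp_def FOr_def FIff_def ext_def) blast
  also have "\<dots> \<longleftrightarrow> (\<exists>x. unbounded x \<and> e n = (succ ^^ Suc k) x)"
  proof -
    have "E y U" if "e n = succ y" for y using trans_set_mem[OF U Suc.prems] mem_succ that by simp
    then show ?thesis by auto
  qed
  finally show ?case .
qed

text \<open>
  If \<open>T\<close> is transitive without \<open>\<in>\<close>-maximal elements, its \<open>k\<close>-th successor is the only \<open>\<in>\<close>-maximal
  element of the \<open>(k + 1)\<close>-st, in which the dial therefore reads exactly \<open>k\<close>.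
\<close>

definition dial :: "nat \<Rightarrow> 'a \<Rightarrow> bool" where
  "dial k U \<longleftrightarrow> (\<exists>x. E x U \<and> (\<forall>y. E y U \<longrightarrow> \<not> E x y) \<and> (\<exists>y. unbounded y \<and> x = (succ ^^ k) y))"

lemma models_dial_fm:
  assumes "trans_set E U"
  shows "models E (ext E U) (dial_fm k) \<longleftrightarrow> dial k U"
  using sat_successor_fm[OF assms] by (auto simp: models_def dial_fm_def dial_def ext_def)

lemma ex_extension_dial:
  assumes "trans_set E U"
  shows "\<exists>W\<in>extensions E U. \<forall>j. dial j W \<longleftrightarrow> j = k"
proof -
  obtain T where T: "trans_set E T" "subset E U T" "unbounded T"
    using ex_transitive_unbounded by blast
  have extension: "(succ ^^ i) T \<in> extensions E U" for i
  proof (induction i)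
    case 0
    show ?case using T by (simp add: extensions_def)
  next
    case (Suc i)
    then show ?case by (simp add: extensions_def trans_set_succ) (simp add: subset_def mem_succ)
  qed
  define S where "S = (succ ^^ k) T"
  have "E x (succ S) \<and> (\<forall>y. E y (succ S) \<longrightarrow> \<not> E x y) \<longleftrightarrow> x = S" for x
    using mem_asym[of S] mem_irrefl by (auto simp: mem_succ)
  then have "dial j (succ S) \<longleftrightarrow> (\<exists>y. unbounded y \<and> S = (succ ^^ j) y)" for j
    unfolding dial_def by (metis (no_types))
  then have "dial j (succ S) \<longleftrightarrow> j = k" for j
    unfolding S_def using T(3) succ_funpow_unbounded_inject[OF T(3)] by metis
  then show ?thesis using extension[of "Suc k"] by (auto simp: S_def)
qed

fun dial_value :: "nat \<Rightarrow> 'a \<Rightarrow> nat" where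
  "dial_value 0 U = 0"
| "dial_value (Suc m) U = (if dial (Suc m) U then Suc m else dial_value m U)"

lemma dial_value_le: "dial_value m U \<le> m"
  by (induction m) (auto intro: le_SucI)

lemma dial_value_eq: "k \<le> m \<Longrightarrow> (\<And>j. dial j U \<longleftrightarrow> j = k) \<Longrightarrow> dial_value m U = k"
  by (induction m) auto

lemma dial_value_extensions:
  assumes "trans_set E U"
  shows "dial_value m ` extensions E U = {..m}"
proof
  show "{..m} \<subseteq> dial_value m ` extensions E U"
  proof
    fix k assume "k \<in> {..m}"
    moreover obtain W where "W \<in> extensions E U" "\<And>j. dial j W \<longleftrightarrow> j = k"
      using ex_extension_dial[OF assms] by blast
    ultimately show "k \<in> dial_value m ` extensions E U" using dial_value_eq[of k m W] by auto
  qed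
qed (use dial_value_le in auto)

lemma ex_models_dial_value:
  "\<exists>\<chi>\<in>lang E M. \<forall>U. trans_set E U \<longrightarrow> (models E (ext E U) \<chi> \<longleftrightarrow> b (dial_value m U))"
proof (induction m)
  case 0
  show ?case using ex_constant_sentence[of E M "b 0"] by auto
next
  case (Suc m)
  then obtain \<chi> where \<chi>: "\<chi> \<in> lang E M"
    "\<And>U. trans_set E U \<Longrightarrow> models E (ext E U) \<chi> \<longleftrightarrow> b (dial_value m U)" by blast
  define \<theta> where "\<theta> =
    (if b (Suc m) then FOr (dial_fm (Suc m)) \<chi> else FAnd (FNeg (dial_fm (Suc m))) \<chi>)"
  have "\<theta> \<in> lang E M"
    using \<chi>(1) by (simp add: \<theta>_def FNeg_in_lang FAnd_in_lang FOr_in_lang dial_fm_in_lang)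
  moreover have closed: "fv \<chi> = {}" "fv (dial_fm (Suc m) :: 'a fm) = {}"
    using \<chi>(1) dial_fm_in_lang[of "Suc m" E M] by (simp_all add: lang_def)
  have "models E (ext E U) \<theta> \<longleftrightarrow> b (dial_value (Suc m) U)" if "trans_set E U" for U
    using \<chi>(2)[OF that] models_dial_fm[OF that]
    by (simp add: \<theta>_def models_FOr models_FAnd models_FNeg closed)
  ultimately show ?case by blast
qed

end

lemma ex_enumeration_with_value:
  assumes "finite T" and "v \<in> T" and r: "\<And>m. r m \<le> (m :: nat)"
  shows "\<exists>m h. h ` {..m} = T \<and> h (r m) = v"
proof -
  obtain n g where g: "T = g ` {i::nat. i < n}"
    using assms(1) unfolding finite_conv_nat_seg_image by blast
  with assms(2) obtain m where "n = Suc m" by (cases n) auto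
  with g have T: "T = g ` {..m}" by (simp add: lessThan_def[symmetric] lessThan_Suc_atMost)
  with assms(2) obtain k where k: "k \<le> m" "g k = v" by blast
  have "(g \<circ> transpose (r m) k) ` {..m} = T"
    unfolding T by (rule swap_image_eq) (use k(1) r[of m] in simp_all)
  moreover have "(g \<circ> transpose (r m) k) (r m) = v" using k(2) by simp
  ultimately show ?thesis by blast
qed

context ZFC
begin

lemma kripke_model_simulated:
  assumes M: "trans_set E M" and "finite T" and "v \<in> T"
  shows "\<exists>\<sigma>. range \<sigma> \<subseteq> lang E M \<and> (\<forall>p. true_at E M (map_modal \<sigma> p) \<longleftrightarrow> kripke_sat T v p)"
proof -
  obtain m h where h: "h ` {..m} = T" "h (dial_value m M) = v"
    using ex_enumeration_with_value[OF assms(2,3), of "\<lambda>m. dial_value m M"] dial_value_le by blast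
  have "\<forall>n. \<exists>\<chi>. \<chi> \<in> lang E M \<and>
      (\<forall>U. trans_set E U \<longrightarrow> (models E (ext E U) \<chi> \<longleftrightarrow> h (dial_value m U) n))"
    using ex_models_dial_value[of M "\<lambda>j. h j n" m for n] by blast
  then obtain \<sigma> where \<sigma>: "\<And>n. \<sigma> n \<in> lang E M"
    "\<And>n U. trans_set E U \<Longrightarrow> models E (ext E U) (\<sigma> n) \<longleftrightarrow> h (dial_value m U) n"
    unfolding choice_iff by blast
  have "true_at E M (map_modal \<sigma> p) \<longleftrightarrow> kripke_sat T (h (dial_value m M)) p" for p
  proof (rule true_at_iff_kripke_sat[where v = "\<lambda>U. h (dial_value m U)"])
    show "(\<lambda>U. h (dial_value m U)) ` extensions E U = T" if "U \<in> extensions E M" for U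
      using that dial_value_extensions[of U m] h(1)
      by (simp add: extensions_def image_image[symmetric])
  qed (use \<sigma>(2) extensions_refl[OF M] in \<open>auto simp: extensions_def\<close>)
  then show ?thesis using \<sigma>(1) h(2) by blast
qed

lemma Val_subset_S5:
  assumes "trans_set E M"
  shows "Val E M (lang E M) \<subseteq> S5"
proof (rule subsetI, rule ccontr)
  fix p assume p: "p \<in> Val E M (lang E M)" and "p \<notin> S5"
  then obtain T v where "finite T" "v \<in> T" "\<not> kripke_sat T v p" using S5_complete_finite by blast
  then obtain \<sigma> where "range \<sigma> \<subseteq> lang E M" "\<not> true_at E M (map_modal \<sigma> p)"
    using kripke_model_simulated[OF assms] by blast
  with p show False unfolding Val_def by blast
qed

lemma Val_eq_S5_iff_Sigma_elementary:
  assumes "trans_set E M"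
  shows "Val E M (lang E M) = S5 \<longleftrightarrow> Sigma_elementary E 2 M"
  using Sigma_elementary_if_S5[OF assms] S5_if_Sigma_elementary[OF assms] Val_subset_S5[OF assms]
  by blast

end

theorem theorem25:
  fixes E :: "'a \<Rightarrow> 'a \<Rightarrow> bool" and M :: 'a
  assumes "ZFC E"
    and "trans_set E M"
  shows "Val E M (lang E M) = S5 \<longleftrightarrow> (\<exists>\<delta>. Sigma_correct_cardinal E 2 \<delta> \<and> is_V E \<delta> M)"
proof -
  interpret ZFC E by (rule assms(1))
  have "Val E M (lang E M) = S5 \<longleftrightarrow> Sigma_elementary E 2 M"
    by (rule Val_eq_S5_iff_Sigma_elementary[OF assms(2)])
  also have "\<dots> \<longleftrightarrow> (\<exists>\<delta>. Sigma_correct_cardinal E 2 \<delta> \<and> is_V E \<delta> M)"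
    by (rule Sigma_elementary_iff_Sigma_correct[OF assms(2)])
  finally show ?thesis .
qed

end
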